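(* For each integer $m\ge1$ let $$\gamma_m=\Bigl[\max_{0\le q<1}(1+q-q^2-q^m)\Bigr]^{-1}.$$ Then $\gamma_m$ is the sharp second-best factor for matching markets with downward-closed feasibility, independent finite priors, binary buyers, and at most $m$ types per seller: every such market satisfies $\mathrm{SB}\ge\gamma_m\mathrm{FB}$, and $\gamma_m$ equals the infimum of $\mathrm{SB}/\mathrm{FB}$ over such markets with $\mathrm{FB}>0$. In particular $\gamma_1=1$, $\gamma_2=8/9$, $\gamma_3=27/32$, and $\gamma_m\downarrow 4/5$ as $m\to\infty$. Each bound is tight bilaterally, i.e. the infimum of $\mathrm{SB}/\mathrm{FB}$ restricted to bilateral-trade instances in the class is also $\gamma_m$.
   Context: A finite matching market consists of finite disjoint sets $B$ (buyers) and $S$ (sellers), a set $E\subseteq B\times S$ of compatible edges, and a nonempty family $\mathcal F$ of matchings of the bipartite graph $(B,S,E)$ that is downward-closed (subsets of members are members). Buyer $i$ has a private real value $v_i$ with finite support, seller $j$ a private real cost $c_j$ with finite support (support points have positive probability); all types are mutually independent with known distributions. An agent is binary if her type has two support points; support points and probabilities may differ across agents. Bilateral trade is the case of one buyer, one seller, one edge $e$ and $\mathcal F=\{\emptyset,\{e\}\}$. A mechanism assigns to every profile of reports (in the supports) a probability distribution over $\mathcal F$, with edge probabilities $x_{ij}$, and a real payment $p_a$ (of either sign) from each agent $a$ to the mechanism. With $q_i=\sum_j x_{ij}$, $y_j=\sum_i x_{ij}$, buyer $i$'s utility is $v_iq_i-p_i$ and seller $j$'s is $-c_jy_j-p_j$.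 BIC: for each agent and type, truthful reporting maximizes expected utility when all others report truthfully. IIR: each type's expected truthful utility is nonnegative. Ex-ante WBB: $\mathbb E[\sum_a p_a]\ge0$. $\mathrm{GFT}=\mathbb E[\sum_{(i,j)\in E}(v_i-c_j)x_{ij}]$; $\mathrm{FB}=\mathbb E[\max_{M\in\mathcal F}\sum_{(i,j)\in M}(v_i-c_j)]$; $\mathrm{SB}$ is the maximum of $\mathrm{GFT}$ over BIC, IIR, ex-ante WBB mechanisms. *)

theory Defs
  imports "HOL-Probability.Probability"
begin

(* Buyers and sellers live in different types, so the two sides are disjoint.
   The prior of an agent is a pmf on the reals; its support is the set of her types. *)
record ('b, 's) market =
  buyers :: "'b set"
  sellers :: "'s set"
  edges :: "('b \<times> 's) set"
  feasible :: "('b \<times> 's) set set"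
  value_prior :: "'b \<Rightarrow> real pmf"
  cost_prior :: "'s \<Rightarrow> real pmf"

definition is_matching :: "('b \<times> 's) set \<Rightarrow> ('b \<times> 's) set \<Rightarrow> bool" where
  "is_matching E M \<longleftrightarrow> M \<subseteq> E \<and> inj_on fst M \<and> inj_on snd M"

definition matching_market :: "('b, 's) market \<Rightarrow> bool" where
  "matching_market K \<longleftrightarrow>
     finite (buyers K) \<and> finite (sellers K) \<and>
     edges K \<subseteq> buyers K \<times> sellers K \<and>
     feasible K \<noteq> {} \<and>
     (\<forall>M\<in>feasible K. is_matching (edges K) M) \<and>
     (\<forall>M\<in>feasible K. \<forall>N. N \<subseteq> M \<longrightarrow> N \<in> feasible K) \<and>
     (\<forall>i\<in>buyers K. finite (set_pmf (value_prior K i))) \<and>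
     (\<forall>j\<in>sellers K. finite (set_pmf (cost_prior K j)))"

definition market_class :: "nat \<Rightarrow> ('b, 's) market \<Rightarrow> bool" where
  "market_class m K \<longleftrightarrow> matching_market K \<and>
     (\<forall>i\<in>buyers K. card (set_pmf (value_prior K i)) = 2) \<and>
     (\<forall>j\<in>sellers K. card (set_pmf (cost_prior K j)) \<le> m)"

definition bilateral :: "('b, 's) market \<Rightarrow> bool" where
  "bilateral K \<longleftrightarrow> (\<exists>i j. buyers K = {i} \<and> sellers K = {j} \<and>
     edges K = {(i, j)} \<and> feasible K = {{}, {(i, j)}})"

type_synonym ('b, 's) profile = "('b \<Rightarrow> real) \<times> ('s \<Rightarrow> real)"

(* Independent types; coordinates outside the market carry the dummy value 0. *)
definition profiles :: "('b, 's) market \<Rightarrow> ('b, 's) profile pmf" where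
  "profiles K = pair_pmf (Pi_pmf (buyers K) 0 (value_prior K)) (Pi_pmf (sellers K) 0 (cost_prior K))"

abbreviation expect :: "('b, 's) market \<Rightarrow> (('b, 's) profile \<Rightarrow> real) \<Rightarrow> real" where
  "expect K f \<equiv> measure_pmf.expectation (profiles K) f"

record ('b, 's) mechanism =
  alloc :: "('b, 's) profile \<Rightarrow> ('b \<times> 's) set pmf"
  buyer_pay :: "('b, 's) profile \<Rightarrow> 'b \<Rightarrow> real"
  seller_pay :: "('b, 's) profile \<Rightarrow> 's \<Rightarrow> real"

(* Only the values of a mechanism at profiles in the support of the prior matter. *)
definition is_mechanism :: "('b, 's) market \<Rightarrow> ('b, 's) mechanism \<Rightarrow> bool" where
  "is_mechanism K A \<longleftrightarrow> (\<forall>t\<in>set_pmf (profiles K). set_pmf (alloc A t) \<subseteq> feasible K)"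

definition edge_prob :: "('b, 's) mechanism \<Rightarrow> ('b, 's) profile \<Rightarrow> 'b \<Rightarrow> 's \<Rightarrow> real" where
  "edge_prob A t i j = measure_pmf.prob (alloc A t) {M. (i, j) \<in> M}"

definition buyer_prob :: "('b, 's) market \<Rightarrow> ('b, 's) mechanism \<Rightarrow> ('b, 's) profile \<Rightarrow> 'b \<Rightarrow> real" where
  "buyer_prob K A t i = (\<Sum>j\<in>sellers K. edge_prob A t i j)"

definition seller_prob :: "('b, 's) market \<Rightarrow> ('b, 's) mechanism \<Rightarrow> ('b, 's) profile \<Rightarrow> 's \<Rightarrow> real" where
  "seller_prob K A t j = (\<Sum>i\<in>buyers K. edge_prob A t i j)"

(* Interim utility of buyer i with true value x who reports r while all others are truthful.
   Types are independent, so overwriting her own coordinate of a random profile by r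
   leaves exactly the expectation over the types of the others. *)
definition buyer_util :: "('b, 's) market \<Rightarrow> ('b, 's) mechanism \<Rightarrow> 'b \<Rightarrow> real \<Rightarrow> real \<Rightarrow> real" where
  "buyer_util K A i x r = expect K (\<lambda>(v, c).
     x * buyer_prob K A (v(i := r), c) i - buyer_pay A (v(i := r), c) i)"

definition seller_util :: "('b, 's) market \<Rightarrow> ('b, 's) mechanism \<Rightarrow> 's \<Rightarrow> real \<Rightarrow> real \<Rightarrow> real" where
  "seller_util K A j x r = expect K (\<lambda>(v, c).
     - x * seller_prob K A (v, c(j := r)) j - seller_pay A (v, c(j := r)) j)"

definition BIC :: "('b, 's) market \<Rightarrow> ('b, 's) mechanism \<Rightarrow> bool" where
  "BIC K A \<longleftrightarrow>
     (\<forall>i\<in>buyers K. \<forall>x\<in>set_pmf (value_prior K i). \<forall>r\<in>set_pmf (value_prior K i).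
        buyer_util K A i x r \<le> buyer_util K A i x x) \<and>
     (\<forall>j\<in>sellers K. \<forall>x\<in>set_pmf (cost_prior K j). \<forall>r\<in>set_pmf (cost_prior K j).
        seller_util K A j x r \<le> seller_util K A j x x)"

definition IIR :: "('b, 's) market \<Rightarrow> ('b, 's) mechanism \<Rightarrow> bool" where
  "IIR K A \<longleftrightarrow>
     (\<forall>i\<in>buyers K. \<forall>x\<in>set_pmf (value_prior K i). 0 \<le> buyer_util K A i x x) \<and>
     (\<forall>j\<in>sellers K. \<forall>x\<in>set_pmf (cost_prior K j). 0 \<le> seller_util K A j x x)"

definition ex_ante_WBB :: "('b, 's) market \<Rightarrow> ('b, 's) mechanism \<Rightarrow> bool" where
  "ex_ante_WBB K A \<longleftrightarrow>
     0 \<le> expect K (\<lambda>t. (\<Sum>i\<in>buyers K. buyer_pay A t i) + (\<Sum>j\<in>sellers K. seller_pay A t j))"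

definition GFT :: "('b, 's) market \<Rightarrow> ('b, 's) mechanism \<Rightarrow> real" where
  "GFT K A = expect K (\<lambda>(v, c). \<Sum>(i, j)\<in>edges K. (v i - c j) * edge_prob A (v, c) i j)"

definition FB :: "('b, 's) market \<Rightarrow> real" where
  "FB K = expect K (\<lambda>(v, c). Max ((\<lambda>M. \<Sum>(i, j)\<in>M. v i - c j) ` feasible K))"

(* A maximum in the source. The set is nonempty (the no-trade mechanism) and bounded by FB;
   its supremum is attained because IIR and WBB bound the interim payments. *)
definition SB :: "('b, 's) market \<Rightarrow> real" where
  "SB K = Sup {GFT K A | A. is_mechanism K A \<and> BIC K A \<and> IIR K A \<and> ex_ante_WBB K A}"

(* The maximum over 0 \<le> q < 1 is attained for m \<ge> 1: the polynomial is 1 at q = 0 and 0 at q = 1. *)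
definition sb_factor :: "nat \<Rightarrow> real" where
  "sb_factor m = inverse (SUP q\<in>{0..<1::real}. 1 + q - q ^ 2 - q ^ m)"

end

theory Submission
  imports Defs
begin

text \<open>Mixing mechanisms makes the set of pairs (gains from trade, revenue) convex, so by separation it
  suffices to find for every \<open>\<alpha> \<in> [0, 1]\<close> an incentive compatible, individually rational mechanism with
  \<open>(\<Sum>s<m. \<alpha>\<^sup>s) + \<alpha>\<close> times \<open>(1 - \<alpha>) GFT + \<alpha> Rev\<close> at least the first best; note that
  \<open>(1 - \<alpha>) ((\<Sum>s<m. \<alpha>\<^sup>s) + \<alpha>) = 1 + \<alpha> - \<alpha>\<^sup>2 - \<alpha>\<^sup>m\<close>.

  Replacing the low values of the buyers by virtual values costs at most \<open>\<alpha>\<close> times the rents of the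
  buyers in the efficient allocation, and these rents are bounded by the revenue of a single mechanism.
  Starting from the optimal allocation under virtual values, let \<open>W(s)\<close> be the welfare after each
  seller loses her \<open>s\<close> largest accepted costs. The sellers' rents at level \<open>s\<close> are at most \<open>W(s + 1)\<close>, so
  the Lagrangian at level \<open>s\<close> is at least \<open>W(s) - \<alpha> W(s + 1)\<close>; as \<open>W(m) = 0\<close>, telescoping bounds \<open>W(0)\<close>.

  The bound is approached by a buyer with a rare high value and a seller whose cost distribution is
  geometric with vanishing ratio.\<close>

subsection \<open>Expectations over type profiles\<close>

locale finite_market =
  fixes K :: "('b, 's) market"
  assumes market: "matching_market K"
begin

lemma finite_buyers [simp]: "finite (buyers K)"
  and finite_sellers [simp]: "finite (sellers K)"
  and edges_subset: "edges K \<subseteq> buyers K \<times> sellers K"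
  and feasible_nonempty: "feasible K \<noteq> {}"
  and feasible_matching: "M \<in> feasible K \<Longrightarrow> is_matching (edges K) M"
  and feasible_mono: "M \<in> feasible K \<Longrightarrow> N \<subseteq> M \<Longrightarrow> N \<in> feasible K"
  and finite_values: "i \<in> buyers K \<Longrightarrow> finite (set_pmf (value_prior K i))"
  and finite_costs: "j \<in> sellers K \<Longrightarrow> finite (set_pmf (cost_prior K j))"
  using market unfolding matching_market_def by blast+

lemma feasible_subset: "M \<in> feasible K \<Longrightarrow> M \<subseteq> buyers K \<times> sellers K"
  using feasible_matching edges_subset unfolding is_matching_def by blast

lemma feasible_fst: "M \<in> feasible K \<Longrightarrow> fst ` M \<subseteq> buyers K"
  using feasible_subset by fastforce

lemma feasible_snd: "M \<in> feasible K \<Longrightarrow> snd ` M \<subseteq> sellers K"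
  using feasible_subset by fastforce

lemma finite_edges: "finite (edges K)"
  using edges_subset by (rule finite_subset) simp

lemma finite_feasible: "finite (feasible K)"
  by (rule finite_subset[of _ "Pow (buyers K \<times> sellers K)"]) (use feasible_subset in auto)

lemma feasible_finite: "M \<in> feasible K \<Longrightarrow> finite M"
  by (rule finite_subset[OF feasible_subset]) simp_all

lemma empty_feasible: "{} \<in> feasible K"
  using feasible_nonempty feasible_mono by blast

lemma matching_fst_unique: "M \<in> feasible K \<Longrightarrow> (i, j) \<in> M \<Longrightarrow> (i, j') \<in> M \<Longrightarrow> j = j'"
  using feasible_matching unfolding is_matching_def inj_on_def by fastforce

lemma matching_snd_unique: "M \<in> feasible K \<Longrightarrow> (i, j) \<in> M \<Longrightarrow> (i', j) \<in> M \<Longrightarrow> i = i'"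
  using feasible_matching unfolding is_matching_def inj_on_def by fastforce

lemma set_profiles: "set_pmf (profiles K) =
    PiE_dflt (buyers K) 0 (\<lambda>i. set_pmf (value_prior K i)) \<times>
    PiE_dflt (sellers K) 0 (\<lambda>j. set_pmf (cost_prior K j))"
  by (simp add: profiles_def set_Pi_pmf comp_def)

lemma finite_profiles: "finite (set_pmf (profiles K))"
  unfolding set_profiles
  by (intro finite_cartesian_product finite_PiE_dflt) (auto simp: finite_values finite_costs)

lemma profile_value: "(v, c) \<in> set_pmf (profiles K) \<Longrightarrow> i \<in> buyers K \<Longrightarrow> v i \<in> set_pmf (value_prior K i)"
  and profile_cost: "(v, c) \<in> set_pmf (profiles K) \<Longrightarrow> j \<in> sellers K \<Longrightarrow> c j \<in> set_pmf (cost_prior K j)"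
  unfolding set_profiles PiE_dflt_def by auto

lemma profile_upd_value: "(v, c) \<in> set_pmf (profiles K) \<Longrightarrow> i \<in> buyers K \<Longrightarrow>
    r \<in> set_pmf (value_prior K i) \<Longrightarrow> (v(i := r), c) \<in> set_pmf (profiles K)"
  and profile_upd_cost: "(v, c) \<in> set_pmf (profiles K) \<Longrightarrow> j \<in> sellers K \<Longrightarrow>
    r \<in> set_pmf (cost_prior K j) \<Longrightarrow> (v, c(j := r)) \<in> set_pmf (profiles K)"
  unfolding set_profiles PiE_dflt_def by auto

lemma integrable_profiles [simp]: "integrable (measure_pmf (profiles K)) (f :: _ \<Rightarrow> real)"
  by (rule integrable_measure_pmf_finite[OF finite_profiles])

lemma expect_mono:
  assumes "\<And>v c. (v, c) \<in> set_pmf (profiles K) \<Longrightarrow> f (v, c) \<le> g (v, c)"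
  shows "expect K f \<le> expect K g"
  by (rule integral_mono_AE) (use assms in \<open>auto simp: AE_measure_pmf_iff\<close>)

lemma expect_cong:
  assumes "\<And>v c. (v, c) \<in> set_pmf (profiles K) \<Longrightarrow> f (v, c) = g (v, c)"
  shows "expect K f = expect K g"
  by (rule integral_cong_AE) (use assms in \<open>auto simp: AE_measure_pmf_iff\<close>)

lemma expect_nonneg:
  assumes "\<And>v c. (v, c) \<in> set_pmf (profiles K) \<Longrightarrow> 0 \<le> f (v, c)"
  shows "0 \<le> expect K f"
  using expect_mono[of "\<lambda>_. 0" f] assms by simp

lemma expect_diff: "expect K (\<lambda>t. f t - g t) = expect K f - expect K g"
  by simp

text \<open>By independence the coordinate of \<open>i\<close> splits off the product, so drawing it
  afresh leaves the law unchanged. This conditions a profile on the type of one buyer.\<close>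

lemma profiles_resample:
  assumes i: "i \<in> buyers K"
  shows "profiles K = value_prior K i \<bind> (\<lambda>r. map_pmf (\<lambda>(v, c). (v(i := r), c)) (profiles K))"
proof -
  let ?B = "buyers K - {i}"
  have "Pi_pmf (insert i ?B) 0 (value_prior K) =
      value_prior K i \<bind> (\<lambda>r. map_pmf (\<lambda>v. v(i := r)) (Pi_pmf (insert i ?B) 0 (value_prior K)))"
    by (subst (1 2) Pi_pmf_insert)
      (auto simp: map_pmf_def pair_pmf_def bind_assoc_pmf bind_return_pmf bind_pmf_const)
  then have eq: "Pi_pmf (buyers K) 0 (value_prior K) =
      value_prior K i \<bind> (\<lambda>r. map_pmf (\<lambda>v. v(i := r)) (Pi_pmf (buyers K) 0 (value_prior K)))"
    using i by (simp add: insert_absorb)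
  show ?thesis
    unfolding profiles_def
    by (subst eq) (simp add: map_pmf_def pair_pmf_def bind_assoc_pmf bind_return_pmf)
qed

lemma expect_resample:
  assumes i: "i \<in> buyers K"
  shows "expect K f = (\<Sum>r\<in>set_pmf (value_prior K i).
    pmf (value_prior K i) r * expect K (\<lambda>(v, c). f (v(i := r), c)))"
  by (subst profiles_resample[OF i], subst pmf_expectation_bind[OF finite_values[OF i]])
    (auto simp: finite_profiles case_prod_unfold)

end

subsection \<open>Maximisation with consistent tie-breaking\<close>

text \<open>Ties are broken by a fixed enumeration of the feasible set, so that a change of one type in
  favour of a matched agent leaves not only the agent matched but the whole matching unchanged.\<close>

definition pick :: "'a set \<Rightarrow> ('a \<Rightarrow> real) \<Rightarrow> 'a" where
  "pick F w = (SOME M. M \<in> F \<and>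
     (\<forall>N\<in>F. w N < w M \<or> w N = w M \<and> to_nat_on F M \<le> to_nat_on F N))"

lemma pick_best:
  assumes "finite F" "F \<noteq> {}"
  shows "pick F w \<in> F \<and> (\<forall>N\<in>F. w N < w (pick F w) \<or>
    w N = w (pick F w) \<and> to_nat_on F (pick F w) \<le> to_nat_on F N)"
proof -
  obtain M0 where M0: "M0 \<in> F" "\<And>N. N \<in> F \<Longrightarrow> w N \<le> w M0"
    using ex_is_arg_min_if_finite[OF assms, of "\<lambda>N. - w N"] unfolding is_arg_min_linorder by auto
  let ?F = "{M \<in> F. w M = w M0}"
  have ne: "finite ?F" "?F \<noteq> {}" using assms(1) M0(1) by auto
  obtain M where "is_arg_min (to_nat_on F) (\<lambda>M. M \<in> ?F) M"
    using ex_is_arg_min_if_finite[OF ne] by blast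
  then have M: "M \<in> F" "w M = w M0"
    "\<And>N. N \<in> F \<Longrightarrow> w N = w M0 \<Longrightarrow> to_nat_on F M \<le> to_nat_on F N"
    unfolding is_arg_min_linorder by blast+
  have "w N < w M \<or> w N = w M \<and> to_nat_on F M \<le> to_nat_on F N" if "N \<in> F" for N
    using M(2) M(3)[OF that] M0(2)[OF that] by linarith
  then have "M \<in> F \<and> (\<forall>N\<in>F. w N < w M \<or> w N = w M \<and> to_nat_on F M \<le> to_nat_on F N)"
    using M(1) by blast
  then show ?thesis
    unfolding pick_def by (rule someI)
qed

lemma pick_eqI:
  assumes "finite F" "M \<in> F"
    and "\<And>N. N \<in> F \<Longrightarrow> w N < w M \<or> w N = w M \<and> to_nat_on F M \<le> to_nat_on F N"
  shows "pick F w = M"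
proof -
  have "F \<noteq> {}" using assms by auto
  note P = pick_best[OF assms(1) this, of w]
  \<comment> \<open>Each of the two weakly beats the other, so weights and indices agree; the
    enumeration is injective.\<close>
  have "to_nat_on F (pick F w) = to_nat_on F M"
    using P assms(2) assms(3)[of "pick F w"] by fastforce
  then show ?thesis
    using P assms inj_on_to_nat_on[OF countable_finite[OF assms(1)]] by (auto simp: inj_on_def)
qed

text \<open>The chosen element receives the whole bonus \<open>d\<close> and every rival at most
  \<open>d\<close>, so all comparisons with it, ties included, survive.\<close>

lemma pick_shift:
  assumes "finite F" "F \<noteq> {}" "0 \<le> d" "P (pick F w)"
    and "\<And>M. M \<in> F \<Longrightarrow> w' M = w M + (if P M then d else 0)"
  shows "pick F w' = pick F w"
proof (rule pick_eqI)
  note P = pick_best[OF assms(1,2), of w]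
  show "pick F w \<in> F" using P by blast
  fix N assume "N \<in> F"
  with P have "w N < w (pick F w) \<or> w N = w (pick F w) \<and> to_nat_on F (pick F w) \<le> to_nat_on F N"
    by blast
  then show "w' N < w' (pick F w) \<or> w' N = w' (pick F w) \<and> to_nat_on F (pick F w) \<le> to_nat_on F N"
    using assms(3-5) P \<open>N \<in> F\<close> by (cases "P N") auto
qed (fact assms(1))

definition surplus :: "('b \<Rightarrow> real) \<Rightarrow> ('s \<Rightarrow> real) \<Rightarrow> ('b \<times> 's) set \<Rightarrow> real" where
  "surplus u c M = (\<Sum>(i, j)\<in>M. u i - c j)"

context finite_market
begin

definition best :: "('b \<Rightarrow> real) \<Rightarrow> ('s \<Rightarrow> real) \<Rightarrow> ('b \<times> 's) set" where
  "best u c = pick (feasible K) (surplus u c)"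

lemma best_feasible: "best u c \<in> feasible K"
  and best_max: "M \<in> feasible K \<Longrightarrow> surplus u c M \<le> surplus u c (best u c)"
  using pick_best[OF finite_feasible feasible_nonempty, of "surplus u c"]
  unfolding best_def by fastforce+

text \<open>In a matching every agent lies on at most one edge, so the sum over edges separates into
  sums over agents. A change of one type then affects a single summand.\<close>

lemma surplus_buyers_sellers:
  assumes "M \<in> feasible K"
  shows "surplus u c M = (\<Sum>i\<in>buyers K. if i \<in> fst ` M then u i else 0) -
    (\<Sum>j\<in>sellers K. if j \<in> snd ` M then c j else 0)"
proof -
  have inj: "inj_on fst M" "inj_on snd M"
    using feasible_matching[OF assms] unfolding is_matching_def by auto
  have "(\<Sum>i\<in>buyers K. if i \<in> fst ` M then u i else 0) = (\<Sum>i\<in>fst ` M. u i)"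
    by (subst sum.inter_restrict[symmetric])
      (use feasible_fst[OF assms] in \<open>auto simp: Int_absorb1\<close>)
  moreover have "(\<Sum>j\<in>sellers K. if j \<in> snd ` M then c j else 0) = (\<Sum>j\<in>snd ` M. c j)"
    by (subst sum.inter_restrict[symmetric])
      (use feasible_snd[OF assms] in \<open>auto simp: Int_absorb1\<close>)
  ultimately show ?thesis
    using inj by (simp add: surplus_def sum.reindex case_prod_unfold sum_subtractf)
qed

text \<open>Deleting the edge leaves a feasible matching by downward closure, and optimality forbids
  that this raises the surplus.\<close>

lemma best_edge_nonneg:
  assumes "(i, j) \<in> best u c"
  shows "c j \<le> u i"
proof -
  have "surplus u c (best u c) = (u i - c j) + surplus u c (best u c - {(i, j)})"
    unfolding surplus_def
    by (subst sum.remove[OF feasible_finite[OF best_feasible] assms]) simp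
  moreover have "surplus u c (best u c - {(i, j)}) \<le> surplus u c (best u c)"
    using best_max feasible_mono[OF best_feasible] by blast
  ultimately show ?thesis by simp
qed

lemma best_raise_value:
  assumes "i \<in> fst ` best u c" "u i \<le> r"
  shows "best (u(i := r)) c = best u c"
  unfolding best_def
proof (rule pick_shift[where P = "\<lambda>M. i \<in> fst ` M" and d = "r - u i"])
  fix M assume M: "M \<in> feasible K"
  have i: "i \<in> buyers K" using assms(1) feasible_fst[OF best_feasible] by blast
  have "(\<Sum>x\<in>buyers K. if x \<in> fst ` M then (u(i := r)) x else 0) =
      (\<Sum>x\<in>buyers K. (if x \<in> fst ` M then u x else 0) +
        (if x = i then (if i \<in> fst ` M then r - u i else 0) else 0))"
    by (rule sum.cong) auto
  also have "\<dots> = (\<Sum>x\<in>buyers K. if x \<in> fst ` M then u x else 0) +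
      (if i \<in> fst ` M then r - u i else 0)"
    using i by (simp add: sum.distrib)
  finally show "surplus (u(i := r)) c M = surplus u c M + (if i \<in> fst ` M then r - u i else 0)"
    unfolding surplus_buyers_sellers[OF M] by linarith
qed (use assms finite_feasible feasible_nonempty in \<open>auto simp: best_def\<close>)

lemma best_lower_cost:
  assumes "j \<in> snd ` best u c" "r \<le> c j"
  shows "best u (c(j := r)) = best u c"
  unfolding best_def
proof (rule pick_shift[where P = "\<lambda>M. j \<in> snd ` M" and d = "c j - r"])
  fix M assume M: "M \<in> feasible K"
  have j: "j \<in> sellers K" using assms(1) feasible_snd[OF best_feasible] by blast
  have "(\<Sum>x\<in>sellers K. if x \<in> snd ` M then (c(j := r)) x else 0) =
      (\<Sum>x\<in>sellers K. (if x \<in> snd ` M then c x else 0) +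
        (if x = j then (if j \<in> snd ` M then r - c j else 0) else 0))"
    by (rule sum.cong) auto
  also have "\<dots> = (\<Sum>x\<in>sellers K. if x \<in> snd ` M then c x else 0) +
      (if j \<in> snd ` M then r - c j else 0)"
    using j by (simp add: sum.distrib)
  finally have eq: "(\<Sum>x\<in>sellers K. if x \<in> snd ` M then (c(j := r)) x else 0) =
      (\<Sum>x\<in>sellers K. if x \<in> snd ` M then c x else 0) + (if j \<in> snd ` M then r - c j else 0)" .
  show "surplus u (c(j := r)) M = surplus u c M + (if j \<in> snd ` M then c j - r else 0)"
    unfolding surplus_buyers_sellers[OF M] eq by (cases "j \<in> snd ` M") simp_all
qed (use assms finite_feasible feasible_nonempty in \<open>auto simp: best_def\<close>)

lemma FB_best: "FB K = expect K (\<lambda>(v, c). surplus v c (best v c))"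
proof -
  have "Max ((\<lambda>M. \<Sum>(i, j)\<in>M. v i - c j) ` feasible K) = surplus v c (best v c)" for v c
    unfolding surplus_def[symmetric]
    by (rule Max_eqI) (use finite_feasible best_max best_feasible in auto)
  then show ?thesis by (simp add: FB_def)
qed

end

subsection \<open>Threshold-price mechanisms\<close>

context finite_market
begin

definition revenue :: "('b, 's) mechanism \<Rightarrow> real" where
  "revenue A = expect K (\<lambda>t. (\<Sum>i\<in>buyers K. buyer_pay A t i) + (\<Sum>j\<in>sellers K. seller_pay A t j))"

definition admissible :: "('b, 's) mechanism \<Rightarrow> bool" where
  "admissible A \<longleftrightarrow> is_mechanism K A \<and> BIC K A \<and> IIR K A"

definition monotone_rule :: "(('b, 's) profile \<Rightarrow> ('b \<times> 's) set) \<Rightarrow> bool" where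
  "monotone_rule X \<longleftrightarrow> (\<forall>t. X t \<in> feasible K) \<and>
     (\<forall>(v, c)\<in>set_pmf (profiles K).
       (\<forall>i\<in>fst ` X (v, c). \<forall>r\<in>set_pmf (value_prior K i). v i \<le> r \<longrightarrow> i \<in> fst ` X (v(i := r), c)) \<and>
       (\<forall>j\<in>snd ` X (v, c). \<forall>r\<in>set_pmf (cost_prior K j). r \<le> c j \<longrightarrow> j \<in> snd ` X (v, c(j := r))))"

lemma monotone_rule_feasible: "monotone_rule X \<Longrightarrow> X t \<in> feasible K"
  unfolding monotone_rule_def by blast

lemma monotone_rule_raise_value:
  "monotone_rule X \<Longrightarrow> (v, c) \<in> set_pmf (profiles K) \<Longrightarrow> i \<in> fst ` X (v, c) \<Longrightarrow>
    r \<in> set_pmf (value_prior K i) \<Longrightarrow> v i \<le> r \<Longrightarrow> i \<in> fst ` X (v(i := r), c)"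
  unfolding monotone_rule_def by (drule conjunct2, drule (1) bspec) (simp only: prod.case)

lemma monotone_rule_lower_cost:
  "monotone_rule X \<Longrightarrow> (v, c) \<in> set_pmf (profiles K) \<Longrightarrow> j \<in> snd ` X (v, c) \<Longrightarrow>
    r \<in> set_pmf (cost_prior K j) \<Longrightarrow> r \<le> c j \<Longrightarrow> j \<in> snd ` X (v, c(j := r))"
  unfolding monotone_rule_def by (drule conjunct2, drule (1) bspec) (simp only: prod.case)

definition accepted_values where
  "accepted_values X v c i = {r \<in> set_pmf (value_prior K i). i \<in> fst ` X (v(i := r), c)}"

definition accepted_costs where
  "accepted_costs X v c j = {r \<in> set_pmf (cost_prior K j). j \<in> snd ` X (v, c(j := r))}"

text \<open>Myerson's critical-type payments on a finite type set. A price ignores the agent's own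
  report, because the acceptance sets overwrite it.\<close>

definition threshold_mechanism where
  "threshold_mechanism X = \<lparr>alloc = (\<lambda>t. return_pmf (X t)),
     buyer_pay = (\<lambda>(v, c) i. if i \<in> fst ` X (v, c) then Min (accepted_values X v c i) else 0),
     seller_pay = (\<lambda>(v, c) j. if j \<in> snd ` X (v, c) then - Max (accepted_costs X v c j) else 0)\<rparr>"

lemma accepted_values_upd [simp]: "accepted_values X (v(i := r)) c i = accepted_values X v c i"
  and accepted_costs_upd [simp]: "accepted_costs X v (c(j := r)) j = accepted_costs X v c j"
  by (simp_all add: accepted_values_def accepted_costs_def)

lemma threshold_buyer_prob:
  assumes "X t \<in> feasible K"
  shows "buyer_prob K (threshold_mechanism X) t i = (if i \<in> fst ` X t then 1 else 0)"
proof -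
  have "(\<Sum>j\<in>sellers K. indicator {M. (i, j) \<in> M} (X t)) = (if i \<in> fst ` X t then 1 else 0 :: real)"
  proof (cases "i \<in> fst ` X t")
    case True
    then obtain j where j: "(i, j) \<in> X t" by auto
    then have js: "j \<in> sellers K" using feasible_subset[OF assms] by auto
    have "(\<Sum>j'\<in>sellers K. indicator {M. (i, j') \<in> M} (X t)) = (\<Sum>j'\<in>sellers K. if j' = j then 1 else 0 :: real)"
      by (rule sum.cong) (use j matching_fst_unique[OF assms] in \<open>auto simp: indicator_def\<close>)
    then show ?thesis using True js by simp
  next
    case False
    then have "(i, j) \<notin> X t" for j by force
    then show ?thesis using False by simp
  qed
  then show ?thesis
    by (simp add: buyer_prob_def edge_prob_def threshold_mechanism_def measure_return_pmf)
qed

lemma threshold_seller_prob: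
  assumes "X t \<in> feasible K"
  shows "seller_prob K (threshold_mechanism X) t j = (if j \<in> snd ` X t then 1 else 0)"
proof -
  have "(\<Sum>i\<in>buyers K. indicator {M. (i, j) \<in> M} (X t)) = (if j \<in> snd ` X t then 1 else 0 :: real)"
  proof (cases "j \<in> snd ` X t")
    case True
    then obtain i where i: "(i, j) \<in> X t" by auto
    then have ib: "i \<in> buyers K" using feasible_subset[OF assms] by auto
    have "(\<Sum>i'\<in>buyers K. indicator {M. (i', j) \<in> M} (X t)) = (\<Sum>i'\<in>buyers K. if i' = i then 1 else 0 :: real)"
      by (rule sum.cong) (use i matching_snd_unique[OF assms] in \<open>auto simp: indicator_def\<close>)
    then show ?thesis using True ib by simp
  next
    case False
    then have "(i, j) \<notin> X t" for i by force
    then show ?thesis using False by simp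
  qed
  then show ?thesis
    by (simp add: seller_prob_def edge_prob_def threshold_mechanism_def measure_return_pmf)
qed

lemma threshold_GFT:
  assumes "\<And>t. X t \<in> feasible K"
  shows "GFT K (threshold_mechanism X) = expect K (\<lambda>(v, c). surplus v c (X (v, c)))"
proof -
  have "(\<Sum>(i, j)\<in>edges K. (v i - c j) * edge_prob (threshold_mechanism X) (v, c) i j) =
      surplus v c (X (v, c))" for v c
  proof -
    have "X (v, c) \<subseteq> edges K"
      using feasible_matching[OF assms] unfolding is_matching_def by auto
    then have "surplus v c (X (v, c)) = (\<Sum>e\<in>edges K. if e \<in> X (v, c) then v (fst e) - c (snd e) else 0)"
      unfolding surplus_def using finite_edges
      by (simp add: sum.inter_restrict[symmetric] Int_absorb1 case_prod_unfold)
    also have "\<dots> = (\<Sum>(i, j)\<in>edges K. (v i - c j) * edge_prob (threshold_mechanism X) (v, c) i j)"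
      by (rule sum.cong)
        (auto simp: edge_prob_def threshold_mechanism_def measure_return_pmf)
    finally show ?thesis by simp
  qed
  then show ?thesis by (simp add: GFT_def)
qed

text \<open>Monotonicity makes the accepted values upward closed within the support, so trading
  means reaching their minimum.\<close>

lemma threshold_accepts_value:
  assumes "monotone_rule X" "(v, c) \<in> set_pmf (profiles K)" "i \<in> buyers K"
  shows "i \<in> fst ` X (v, c) \<longleftrightarrow> accepted_values X v c i \<noteq> {} \<and> Min (accepted_values X v c i) \<le> v i"
proof -
  let ?A = "accepted_values X v c i"
  have fin: "finite ?A" using finite_values[OF assms(3)] by (simp add: accepted_values_def)
  have vi: "v i \<in> set_pmf (value_prior K i)" using profile_value assms by blast
  show ?thesis
  proof
    assume "i \<in> fst ` X (v, c)"
    then have "v i \<in> ?A" using vi by (simp add: accepted_values_def)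
    then show "?A \<noteq> {} \<and> Min ?A \<le> v i" using fin by auto
  next
    assume ne: "?A \<noteq> {} \<and> Min ?A \<le> v i"
    then have "Min ?A \<in> ?A" using fin by simp
    then have "Min ?A \<in> set_pmf (value_prior K i)" "i \<in> fst ` X (v(i := Min ?A), c)"
      by (auto simp: accepted_values_def)
    moreover have "(v(i := Min ?A), c) \<in> set_pmf (profiles K)"
      using profile_upd_value[OF assms(2,3)] calculation by blast
    \<comment> \<open>Monotonicity is applied at the profile in which \<open>i\<close> reports the
      price; the second update restores the true value.\<close>
    ultimately have "i \<in> fst ` X ((v(i := Min ?A))(i := v i), c)"
      using vi ne by (intro monotone_rule_raise_value[OF assms(1), of "v(i := Min ?A)"]) simp_all
    then show "i \<in> fst ` X (v, c)" by simp
  qed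
qed

lemma threshold_accepts_cost:
  assumes "monotone_rule X" "(v, c) \<in> set_pmf (profiles K)" "j \<in> sellers K"
  shows "j \<in> snd ` X (v, c) \<longleftrightarrow> accepted_costs X v c j \<noteq> {} \<and> c j \<le> Max (accepted_costs X v c j)"
proof -
  let ?A = "accepted_costs X v c j"
  have fin: "finite ?A" using finite_costs[OF assms(3)] by (simp add: accepted_costs_def)
  have cj: "c j \<in> set_pmf (cost_prior K j)" using profile_cost assms by blast
  show ?thesis
  proof
    assume "j \<in> snd ` X (v, c)"
    then have "c j \<in> ?A" using cj by (simp add: accepted_costs_def)
    then show "?A \<noteq> {} \<and> c j \<le> Max ?A" using fin by auto
  next
    assume ne: "?A \<noteq> {} \<and> c j \<le> Max ?A"
    then have "Max ?A \<in> ?A" using fin by simp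
    then have "Max ?A \<in> set_pmf (cost_prior K j)" "j \<in> snd ` X (v, c(j := Max ?A))"
      by (auto simp: accepted_costs_def)
    moreover have "(v, c(j := Max ?A)) \<in> set_pmf (profiles K)"
      using profile_upd_cost[OF assms(2,3)] calculation by blast
    ultimately have "j \<in> snd ` X (v, (c(j := Max ?A))(j := c j))"
      using cj ne by (intro monotone_rule_lower_cost[OF assms(1), of _ "c(j := Max ?A)"]) simp_all
    then show "j \<in> snd ` X (v, c)" by simp
  qed
qed

text \<open>Each agent faces a take-it-or-leave-it price set by the others' reports and trades
  exactly when her reported type accepts it. Both constraints therefore hold profile by profile,
  before taking expectations.\<close>

lemma threshold_admissible:
  assumes X: "monotone_rule X"
  shows "admissible (threshold_mechanism X)"
proof -
  note feas = monotone_rule_feasible[OF X]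
  have bu: "buyer_util K (threshold_mechanism X) i x r =
      expect K (\<lambda>(v, c). if i \<in> fst ` X (v(i := r), c) then x - Min (accepted_values X v c i) else 0)"
    for i x r
    unfolding buyer_util_def threshold_buyer_prob[OF feas]
    by (rule arg_cong[of _ _ "expect K"]) (auto simp: threshold_mechanism_def fun_eq_iff)
  have su: "seller_util K (threshold_mechanism X) j x r =
      expect K (\<lambda>(v, c). if j \<in> snd ` X (v, c(j := r)) then Max (accepted_costs X v c j) - x else 0)"
    for j x r
    unfolding seller_util_def threshold_seller_prob[OF feas]
    by (rule arg_cong[of _ _ "expect K"]) (auto simp: threshold_mechanism_def fun_eq_iff)
  have bacc: "i \<in> fst ` X (v(i := x), c) \<longleftrightarrow>
      accepted_values X v c i \<noteq> {} \<and> Min (accepted_values X v c i) \<le> x"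
    if "(v, c) \<in> set_pmf (profiles K)" "i \<in> buyers K" "x \<in> set_pmf (value_prior K i)" for v c i x
    using threshold_accepts_value[OF X profile_upd_value[OF that] that(2)] by simp
  have sacc: "j \<in> snd ` X (v, c(j := x)) \<longleftrightarrow>
      accepted_costs X v c j \<noteq> {} \<and> x \<le> Max (accepted_costs X v c j)"
    if "(v, c) \<in> set_pmf (profiles K)" "j \<in> sellers K" "x \<in> set_pmf (cost_prior K j)" for v c j x
    using threshold_accepts_cost[OF X profile_upd_cost[OF that] that(2)] by simp
  have "BIC K (threshold_mechanism X)"
    unfolding BIC_def bu su
    by (intro conjI ballI expect_mono) (auto simp: bacc sacc)
  moreover have "IIR K (threshold_mechanism X)"
    unfolding IIR_def bu su
    by (intro conjI ballI expect_nonneg) (auto simp: bacc sacc)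
  moreover have "is_mechanism K (threshold_mechanism X)"
    using feas by (simp add: is_mechanism_def threshold_mechanism_def)
  ultimately show ?thesis by (simp add: admissible_def)
qed

lemma threshold_revenue:
  "revenue (threshold_mechanism X) = expect K (\<lambda>(v, c).
    (\<Sum>i\<in>buyers K. if i \<in> fst ` X (v, c) then Min (accepted_values X v c i) else 0) -
    (\<Sum>j\<in>sellers K. if j \<in> snd ` X (v, c) then Max (accepted_costs X v c j) else 0))"
  unfolding revenue_def
  by (rule arg_cong[of _ _ "expect K"])
    (auto simp: threshold_mechanism_def fun_eq_iff sum_negf[symmetric] intro!: sum.cong)

end

subsection \<open>Trimming the acceptance sets of the sellers\<close>

text \<open>Applied to the standing costs of a seller (those at which the optimal matching keeps her), each
  deletion of a largest element lowers her price by one type; \<open>seller_rent_trim\<close> pays for the rents at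
  one level by the surplus at the next.\<close>

definition core :: "nat \<Rightarrow> real set \<Rightarrow> real set" where
  "core s A = {x \<in> A. s < card {y \<in> A. x \<le> y}}"

lemma core_subset: "core s A \<subseteq> A"
  by (auto simp: core_def)

lemma core_0: "finite A \<Longrightarrow> core 0 A = A"
  by (auto simp: core_def card_gt_0_iff)

lemma core_empty:
  assumes "finite A" "card A \<le> s"
  shows "core s A = {}"
proof -
  have "card {y \<in> A. x \<le> y} \<le> s" for x
    using card_mono[OF assms(1), of "{y \<in> A. x \<le> y}"] assms(2) by fastforce
  then show ?thesis by (auto simp: core_def not_less)
qed

lemma core_mono:
  assumes "finite B" "A \<subseteq> B"
  shows "core s A \<subseteq> core s B"
proof
  fix x assume x: "x \<in> core s A"
  have "card {y \<in> A. x \<le> y} \<le> card {y \<in> B. x \<le> y}"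
    using assms by (intro card_mono) auto
  then show "x \<in> core s B" using x assms(2) by (auto simp: core_def)
qed

lemma core_downward:
  assumes "finite A" "x \<in> core s A" "y \<in> A" "y \<le> x"
  shows "y \<in> core s A"
proof -
  have "card {z \<in> A. x \<le> z} \<le> card {z \<in> A. y \<le> z}"
    using assms by (intro card_mono) auto
  then show ?thesis using assms by (auto simp: core_def)
qed

lemma core_antimono_Suc: "core (Suc s) A \<subseteq> core s A"
  by (auto simp: core_def)

text \<open>For an element below the maximum, the more than \<open>s\<close> elements counted at the
  maximum are joined by the element itself. So at most the maximum is lost at the next
  level.\<close>

lemma core_Suc:
  assumes "finite A" "x \<in> core s A" "x \<noteq> Max (core s A)"
  shows "x \<in> core (Suc s) A"
proof -
  let ?m = "Max (core s A)"
  have fin: "finite (core s A)" using core_subset assms(1) by (rule finite_subset)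
  have "?m \<in> core s A" using Max_in[OF fin] assms(2) by blast
  moreover have "x < ?m" using Max_ge[OF fin assms(2)] assms(3) by simp
  ultimately have m: "?m \<in> core s A" "x < ?m" .
  have xA: "x \<in> A" using core_subset assms(2) by blast
  have "s < card {y \<in> A. ?m \<le> y}"
    using m(1) by (subst (asm) core_def) simp
  moreover have "card (insert x {y \<in> A. ?m \<le> y}) = Suc (card {y \<in> A. ?m \<le> y})"
    using m(2) assms(1) by (subst card_insert_disjoint) auto
  moreover have "card (insert x {y \<in> A. ?m \<le> y}) \<le> card {y \<in> A. x \<le> y}"
    using m(2) assms(1) xA by (intro card_mono) auto
  ultimately show ?thesis using xA by (simp add: core_def)
qed

context finite_market
begin

definition standing :: "('b \<Rightarrow> real) \<Rightarrow> ('s \<Rightarrow> real) \<Rightarrow> 's \<Rightarrow> real set" where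
  "standing u c j = {r \<in> set_pmf (cost_prior K j). j \<in> snd ` best u (c(j := r))}"

text \<open>The optimal matching is not recomputed: edges are only deleted from it, each according
  to the standing costs of its own seller.\<close>

definition trim :: "nat \<Rightarrow> ('b \<Rightarrow> real) \<Rightarrow> ('s \<Rightarrow> real) \<Rightarrow> ('b \<times> 's) set" where
  "trim s u c = {(i, j) \<in> best u c. c j \<in> core s (standing u c j)}"

lemma standing_upd [simp]: "standing u (c(j := r)) j = standing u c j"
  by (simp add: standing_def)

lemma trim_subset: "trim s u c \<subseteq> best u c"
  by (auto simp: trim_def)

lemma trim_feasible: "trim s u c \<in> feasible K"
  using feasible_mono[OF best_feasible trim_subset] .

text \<open>Passing from the higher to the lower of the two costs keeps the whole matching. Hence a
  seller has the same partner at all her standing costs.\<close>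

lemma best_same_cost:
  assumes "j \<in> snd ` best u (c(j := r))" "j \<in> snd ` best u (c(j := r'))"
  shows "best u (c(j := r)) = best u (c(j := r'))"
proof (cases "r' \<le> r")
  case True
  then show ?thesis using best_lower_cost[OF assms(1), of r'] by simp
next
  case False
  then show ?thesis using best_lower_cost[OF assms(2), of r] by simp
qed

lemma seller_in_trim: "j \<in> snd ` trim s u c \<longleftrightarrow> c j \<in> core s (standing u c j)"
proof
  assume "c j \<in> core s (standing u c j)"
  moreover from this have "j \<in> snd ` best u (c(j := c j))"
    using core_subset by (fastforce simp: standing_def)
  ultimately show "j \<in> snd ` trim s u c" by (force simp: trim_def)
qed (auto simp: trim_def)

lemma finite_standing: "j \<in> sellers K \<Longrightarrow> finite (standing u c j)"
  using finite_costs by (simp add: standing_def)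

lemma trim_0:
  assumes "\<And>j. j \<in> sellers K \<Longrightarrow> c j \<in> set_pmf (cost_prior K j)"
  shows "trim 0 u c = best u c"
proof -
  have "c j \<in> core 0 (standing u c j)" if "(i, j) \<in> best u c" for i j
  proof -
    have j: "j \<in> sellers K" using that feasible_subset[OF best_feasible] by blast
    have "c j \<in> standing u c j" using that assms[OF j] by (force simp: standing_def)
    then show ?thesis by (simp add: core_0[OF finite_standing[OF j]])
  qed
  then show ?thesis by (auto simp: trim_def)
qed

text \<open>Here the number of types per seller enters: with at most \<open>s\<close> types,
  \<open>s\<close> deletions exhaust her standing costs, which ends the telescoping.\<close>

lemma trim_empty:
  assumes "\<And>j. j \<in> sellers K \<Longrightarrow> card (set_pmf (cost_prior K j)) \<le> s"
  shows "trim s u c = {}"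
proof -
  have "core s (standing u c j) = {}" if "j \<in> sellers K" for j
  proof (rule core_empty[OF finite_standing[OF that]])
    have "card (standing u c j) \<le> card (set_pmf (cost_prior K j))"
      unfolding standing_def by (rule card_mono[OF finite_costs[OF that]]) auto
    then show "card (standing u c j) \<le> s" using assms[OF that] by simp
  qed
  moreover have "j \<in> sellers K" if "(i, j) \<in> best u c" for i j
    using that feasible_subset[OF best_feasible] by blast
  ultimately show ?thesis by (fastforce simp: trim_def)
qed

text \<open>At every standing cost of the seller \<open>j\<close> matched to \<open>i\<close>, her
  partner is still \<open>i\<close>, so a higher value of \<open>i\<close> keeps the matching. The
  standing set of \<open>j\<close> can only grow, and \<open>core\<close> is monotone.\<close>

lemma trim_raise_value:
  assumes "i \<in> fst ` trim s u c" "u i \<le> r"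
  shows "i \<in> fst ` trim s (u(i := r)) c"
proof -
  obtain j where j: "(i, j) \<in> best u c" "c j \<in> core s (standing u c j)"
    using assms(1) by (auto simp: trim_def)
  have js: "j \<in> sellers K" using j(1) feasible_subset[OF best_feasible] by blast
  have "standing u c j \<subseteq> standing (u(i := r)) c j"
  proof
    fix x assume x: "x \<in> standing u c j"
    then have "best u (c(j := x)) = best u (c(j := c j))"
      using j(1) by (intro best_same_cost) (force simp: standing_def)+
    then have ij: "(i, j) \<in> best u (c(j := x))" using j(1) by simp
    then have "best (u(i := r)) (c(j := x)) = best u (c(j := x))"
      using assms(2) by (intro best_raise_value) force+
    then show "x \<in> standing (u(i := r)) c j" using x by (simp add: standing_def)
  qed
  then have "c j \<in> core s (standing (u(i := r)) c j)"
    using core_mono[OF finite_standing[OF js]] j(2) by blast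
  moreover have "best (u(i := r)) c = best u c"
    using j(1) assms(2) by (intro best_raise_value) force+
  ultimately show ?thesis using j(1) by (force simp: trim_def)
qed

lemma trim_lower_cost:
  assumes "j \<in> snd ` trim s u c" "r \<le> c j" "r \<in> set_pmf (cost_prior K j)"
  shows "j \<in> snd ` trim s u (c(j := r))"
proof -
  have js: "j \<in> sellers K" using assms(1) feasible_snd[OF trim_feasible] by blast
  have "j \<in> snd ` best u c" using assms(1) trim_subset by blast
  moreover from this have "best u (c(j := r)) = best u c"
    using assms(2) by (rule best_lower_cost)
  ultimately have "r \<in> standing u c j"
    using assms(3) by (simp add: standing_def)
  then show ?thesis
    using assms(1,2) core_downward[OF finite_standing[OF js]] by (simp add: seller_in_trim)
qed

lemma seller_rent_trim:
  assumes "\<And>j. j \<in> sellers K \<Longrightarrow> c j \<in> set_pmf (cost_prior K j)"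
  shows "(\<Sum>j\<in>sellers K. if j \<in> snd ` trim s u c then Max (core s (standing u c j)) - c j else 0)
    \<le> surplus u c (trim (Suc s) u c)"
proof -
  let ?M = "trim s u c" and ?N = "trim (Suc s) u c"
  let ?r = "\<lambda>j. Max (core s (standing u c j)) - c j"
  have sub: "?N \<subseteq> ?M" using core_antimono_Suc by (force simp: trim_def)
  have fin: "finite ?M" using feasible_finite[OF trim_feasible] .
  have js: "j \<in> sellers K" if "(i, j) \<in> ?M" for i j
    using that feasible_subset[OF trim_feasible] by blast
  have "(\<Sum>j\<in>sellers K. if j \<in> snd ` ?M then ?r j else 0) = (\<Sum>j\<in>snd ` ?M. ?r j)"
    by (subst sum.inter_restrict[symmetric])
      (use feasible_snd[OF trim_feasible] in \<open>auto simp: Int_absorb1\<close>)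
  also have "\<dots> = (\<Sum>e\<in>?M. ?r (snd e))"
    using feasible_matching[OF trim_feasible] unfolding is_matching_def
    by (subst sum.reindex) auto
  also have "\<dots> = (\<Sum>e\<in>?N. ?r (snd e)) + (\<Sum>e\<in>?M - ?N. ?r (snd e))"
    using sum.subset_diff[OF sub fin, of "\<lambda>e. ?r (snd e)"] by simp
  \<comment> \<open>A seller on a deleted edge has exactly the largest remaining cost, which is her
    price, so her rent is zero.\<close>
  also have "(\<Sum>e\<in>?M - ?N. ?r (snd e)) = 0"
  proof (rule sum.neutral, rule ballI)
    fix e assume e: "e \<in> ?M - ?N"
    obtain i j where ij: "e = (i, j)" by (cases e)
    have "(i, j) \<in> ?M" "c j \<in> core s (standing u c j)" "c j \<notin> core (Suc s) (standing u c j)"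
      using e unfolding ij by (auto simp: trim_def)
    then show "?r (snd e) = 0"
      using core_Suc[OF finite_standing[OF js]] unfolding ij by fastforce
  qed
  \<comment> \<open>The price is itself a standing cost with the same partner, so the partner's
    \<open>u\<close> covers it.\<close>
  also have "(\<Sum>e\<in>?N. ?r (snd e)) \<le> (\<Sum>e\<in>?N. u (fst e) - c (snd e))"
  proof (rule sum_mono)
    fix e assume e: "e \<in> ?N"
    obtain i j where ij: "e = (i, j)" by (cases e)
    have iM: "(i, j) \<in> ?M" "(i, j) \<in> best u c" "c j \<in> core s (standing u c j)"
      using e sub unfolding ij by (auto simp: trim_def)
    let ?x = "Max (core s (standing u c j))"
    have "finite (core s (standing u c j))"
      using finite_subset[OF core_subset finite_standing[OF js[OF iM(1)]]] .
    then have "?x \<in> core s (standing u c j)" using iM(3) by (auto intro: Max_in)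
    then have x: "j \<in> snd ` best u (c(j := ?x))"
      using core_subset by (fastforce simp: standing_def)
    have "best u (c(j := ?x)) = best u (c(j := c j))"
      by (rule best_same_cost[OF x]) (use iM(2) in force)
    then have "(i, j) \<in> best u (c(j := ?x))" using iM(2) by simp
    from best_edge_nonneg[OF this] show "?r (snd e) \<le> u (fst e) - c (snd e)"
      unfolding ij by simp
  qed
  finally show ?thesis by (simp add: surplus_def case_prod_unfold)
qed

end

subsection \<open>Binary buyers\<close>

locale binary_market = finite_market K for K :: "('b, 's) market" +
  assumes binary: "i \<in> buyers K \<Longrightarrow> card (set_pmf (value_prior K i)) = 2"
begin

definition low :: "'b \<Rightarrow> real" where "low i = Min (set_pmf (value_prior K i))"
definition high :: "'b \<Rightarrow> real" where "high i = Max (set_pmf (value_prior K i))"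
text \<open>The inverse hazard ratio (1 - F) / f at the low type of a two-point
  distribution.\<close>

definition odds :: "'b \<Rightarrow> real" where
  "odds i = pmf (value_prior K i) (high i) / pmf (value_prior K i) (low i)"

text \<open>Myerson's virtual value is the case \<^term>\<open>\<alpha> = (1 :: real)\<close>.\<close>

definition virt :: "real \<Rightarrow> 'b \<Rightarrow> real \<Rightarrow> real" where
  "virt \<alpha> i x = x - (if x = low i then \<alpha> * odds i * (high i - low i) else 0)"

lemma buyer_types:
  assumes "i \<in> buyers K"
  shows "set_pmf (value_prior K i) = {low i, high i}" "low i < high i"
proof -
  obtain a b where "set_pmf (value_prior K i) = {a, b}" "a \<noteq> b"
    using binary[OF assms] by (auto simp: card_2_iff)
  then show "set_pmf (value_prior K i) = {low i, high i}" "low i < high i"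
    by (auto simp: low_def high_def min_def max_def)
qed

lemma odds_nonneg: "0 \<le> odds i"
  by (simp add: odds_def)

lemma virt_mono:
  assumes "i \<in> buyers K" "0 \<le> \<alpha>" "x \<le> y"
    "x \<in> set_pmf (value_prior K i)" "y \<in> set_pmf (value_prior K i)"
  shows "virt \<alpha> i x \<le> virt \<alpha> i y"
proof -
  have "0 \<le> \<alpha> * odds i * (high i - low i)"
    using assms(2) odds_nonneg buyer_types(2)[OF assms(1)] by simp
  then show ?thesis
    using assms(3-5) buyer_types[OF assms(1)] by (auto simp: virt_def)
qed

text \<open>Once the coordinate of \<open>i\<close> is overwritten, \<open>h\<close> no longer
  depends on her type, and \<open>odds\<close> times the probability of the low type is that of the
  high type. Rents of high types can thus be charged to low types.\<close>

lemma expect_swap: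
  assumes i: "i \<in> buyers K"
  shows "expect K (\<lambda>(v, c). (if v i = low i then odds i else 0) * h (v(i := low i), c)) =
    expect K (\<lambda>(v, c). (if v i = high i then 1 else 0) * h (v(i := low i), c))"
proof -
  have "pmf (value_prior K i) (low i) \<noteq> 0"
    using buyer_types[OF i] by (simp add: set_pmf_iff[symmetric])
  then show ?thesis
    using buyer_types[OF i]
    by (subst (1 2) expect_resample[OF i]) (auto simp: case_prod_unfold odds_def)
qed

lemma min_accepted_values:
  assumes "monotone_rule X" "(v, c) \<in> set_pmf (profiles K)" "i \<in> buyers K" "i \<in> fst ` X (v, c)"
  shows "Min (accepted_values X v c i) = (if i \<in> fst ` X (v(i := low i), c) then low i else high i)"
proof -
  have "v i \<in> {low i, high i}" using profile_value[OF assms(2,3)] buyer_types[OF assms(3)] by simp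
  then have "i \<in> fst ` X (v(i := high i), c)"
    using buyer_types[OF assms(3)] by (intro monotone_rule_raise_value[OF assms(1,2,4)]) auto
  then have "accepted_values X v c i = (if i \<in> fst ` X (v(i := low i), c) then {low i, high i} else {high i})"
    using buyer_types[OF assms(3)] by (auto simp: accepted_values_def)
  then show ?thesis using buyer_types(2)[OF assms(3)] by simp
qed

text \<open>Myerson's payment identity with weight \<alpha> on payments. The integrands differ
  pointwise by a multiple of \<open>L t - H t\<close>, whose expectation vanishes by
  \<open>expect_swap\<close>.\<close>

lemma expect_virtual_value:
  assumes X: "monotone_rule X"
  shows "expect K (\<lambda>(v, c). \<Sum>i\<in>buyers K. if i \<in> fst ` X (v, c)
      then (1 - \<alpha>) * v i + \<alpha> * Min (accepted_values X v c i) else 0) =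
    expect K (\<lambda>(v, c). \<Sum>i\<in>buyers K. if i \<in> fst ` X (v, c) then virt \<alpha> i (v i) else 0)"
proof -
  have "expect K (\<lambda>(v, c). if i \<in> fst ` X (v, c)
      then (1 - \<alpha>) * v i + \<alpha> * Min (accepted_values X v c i) else 0) =
    expect K (\<lambda>(v, c). if i \<in> fst ` X (v, c) then virt \<alpha> i (v i) else 0)" if i: "i \<in> buyers K" for i
  proof -
    define h where "h = (\<lambda>t. if i \<in> fst ` X t then 1 else 0 :: real)"
    define L where "L = (\<lambda>(v, c). (if v i = low i then odds i else 0) * h (v(i := low i), c))"
    define H where "H = (\<lambda>(v, c). (if v i = high i then 1 else 0) * h (v(i := low i), c))"
    have "expect K (\<lambda>(v, c). if i \<in> fst ` X (v, c)
        then (1 - \<alpha>) * v i + \<alpha> * Min (accepted_values X v c i) else 0) =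
      expect K (\<lambda>t. (case t of (v, c) \<Rightarrow> if i \<in> fst ` X (v, c) then virt \<alpha> i (v i) else 0) +
        \<alpha> * (high i - low i) * (L t - H t))"
    proof (rule expect_cong)
      fix v c assume vc: "(v, c) \<in> set_pmf (profiles K)"
      have "(if i \<in> fst ` X (v, c) then (1 - \<alpha>) * v i + \<alpha> * Min (accepted_values X v c i) else 0) =
        (if i \<in> fst ` X (v, c) then virt \<alpha> i (v i) else 0) +
        \<alpha> * (high i - low i) * (L (v, c) - H (v, c))"
      proof (cases "v i = low i")
        case True
        then have "v(i := low i) = v" by (metis fun_upd_triv)
        then show ?thesis
          using True buyer_types(2)[OF i] min_accepted_values[OF X vc i]
          by (simp add: virt_def L_def H_def h_def algebra_simps)
      next
        case False
        then have v: "v i = high i" using profile_value[OF vc i] buyer_types[OF i] by simp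
        have "i \<in> fst ` X ((v(i := low i))(i := v i), c)" if "i \<in> fst ` X (v(i := low i), c)"
        proof (rule monotone_rule_raise_value[OF X _ that])
          show "(v(i := low i), c) \<in> set_pmf (profiles K)"
            by (rule profile_upd_value[OF vc i]) (simp add: buyer_types[OF i])
        qed (use v buyer_types[OF i] in auto)
        then have "i \<in> fst ` X (v(i := low i), c) \<Longrightarrow> i \<in> fst ` X (v, c)" by simp
        then show ?thesis
          using v False min_accepted_values[OF X vc i]
          by (cases "i \<in> fst ` X (v(i := low i), c)")
            (simp_all add: virt_def L_def H_def h_def algebra_simps)
      qed
      then show "(case (v, c) of (v, c) \<Rightarrow> if i \<in> fst ` X (v, c)
          then (1 - \<alpha>) * v i + \<alpha> * Min (accepted_values X v c i) else 0) =
        (case (v, c) of (v, c) \<Rightarrow> if i \<in> fst ` X (v, c) then virt \<alpha> i (v i) else 0) +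
        \<alpha> * (high i - low i) * (L (v, c) - H (v, c))" by simp
    qed
    also have "\<dots> = expect K (\<lambda>(v, c). if i \<in> fst ` X (v, c) then virt \<alpha> i (v i) else 0) +
        \<alpha> * (high i - low i) * (expect K L - expect K H)"
      by simp
    also have "expect K L = expect K H"
      unfolding L_def H_def by (rule expect_swap[OF i])
    finally show ?thesis by simp
  qed
  then show ?thesis by (simp add: case_prod_unfold)
qed

section \<open>Virtual surplus and the Lagrangian\<close>

definition virts :: "real \<Rightarrow> ('b \<Rightarrow> real) \<Rightarrow> 'b \<Rightarrow> real" where
  "virts \<alpha> v = (\<lambda>i. virt \<alpha> i (v i))"

lemma virts_upd: "virts \<alpha> (v(i := r)) = (virts \<alpha> v)(i := virt \<alpha> i r)"
  by (auto simp: virts_def)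

text \<open>For \<alpha> < 1 this is, up to scaling, the Lagrangian with multiplier
  \<open>\<alpha> / (1 - \<alpha>)\<close> on the budget constraint; the scaling admits pure revenue
  as the case \<alpha> = 1.\<close>

definition lagrangian :: "real \<Rightarrow> ('b, 's) mechanism \<Rightarrow> real" where
  "lagrangian \<alpha> A = (1 - \<alpha>) * GFT K A + \<alpha> * revenue A"

text \<open>Only the buyers' payments turn into virtual values. The sellers' rents stay explicit, to
  be compared with the surplus at the next level of trimming.\<close>

lemma lagrangian_threshold:
  assumes X: "monotone_rule X"
  shows "lagrangian \<alpha> (threshold_mechanism X) = expect K (\<lambda>(v, c).
    surplus (virts \<alpha> v) c (X (v, c)) -
    \<alpha> * (\<Sum>j\<in>sellers K. if j \<in> snd ` X (v, c) then Max (accepted_costs X v c j) - c j else 0))"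
proof -
  note feas = monotone_rule_feasible[OF X]
  let ?S = "\<lambda>(v, c). (\<Sum>j\<in>sellers K. if j \<in> snd ` X (v, c)
      then (1 - \<alpha>) * c j + \<alpha> * Max (accepted_costs X v c j) else 0)"
  have "lagrangian \<alpha> (threshold_mechanism X) = expect K (\<lambda>t. (1 - \<alpha>) * (case t of (v, c) \<Rightarrow>
      surplus v c (X (v, c))) + \<alpha> * (case t of (v, c) \<Rightarrow>
      (\<Sum>i\<in>buyers K. if i \<in> fst ` X (v, c) then Min (accepted_values X v c i) else 0) -
      (\<Sum>j\<in>sellers K. if j \<in> snd ` X (v, c) then Max (accepted_costs X v c j) else 0)))"
    unfolding lagrangian_def threshold_GFT[OF feas] threshold_revenue by simp
  also have "\<dots> = expect K (\<lambda>t. (case t of (v, c) \<Rightarrow> (\<Sum>i\<in>buyers K. if i \<in> fst ` X (v, c)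
      then (1 - \<alpha>) * v i + \<alpha> * Min (accepted_values X v c i) else 0)) - ?S t)"
  proof (rule expect_cong)
    fix v c
    have "(\<Sum>i\<in>buyers K. if i \<in> fst ` X (v, c) then (1 - \<alpha>) * v i + \<alpha> * Min (accepted_values X v c i) else 0)
      = (1 - \<alpha>) * (\<Sum>i\<in>buyers K. if i \<in> fst ` X (v, c) then v i else 0) +
        \<alpha> * (\<Sum>i\<in>buyers K. if i \<in> fst ` X (v, c) then Min (accepted_values X v c i) else 0)"
      unfolding sum_distrib_left sum.distrib[symmetric] by (rule sum.cong) auto
    moreover have "?S (v, c)
      = (1 - \<alpha>) * (\<Sum>j\<in>sellers K. if j \<in> snd ` X (v, c) then c j else 0) +
        \<alpha> * (\<Sum>j\<in>sellers K. if j \<in> snd ` X (v, c) then Max (accepted_costs X v c j) else 0)"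
      unfolding sum_distrib_left sum.distrib[symmetric] prod.case by (rule sum.cong) auto
    ultimately show "(1 - \<alpha>) * (case (v, c) of (v, c) \<Rightarrow>
      surplus v c (X (v, c))) + \<alpha> * (case (v, c) of (v, c) \<Rightarrow>
      (\<Sum>i\<in>buyers K. if i \<in> fst ` X (v, c) then Min (accepted_values X v c i) else 0) -
      (\<Sum>j\<in>sellers K. if j \<in> snd ` X (v, c) then Max (accepted_costs X v c j) else 0)) =
      (case (v, c) of (v, c) \<Rightarrow> (\<Sum>i\<in>buyers K. if i \<in> fst ` X (v, c)
      then (1 - \<alpha>) * v i + \<alpha> * Min (accepted_values X v c i) else 0)) - ?S (v, c)"
      unfolding prod.case surplus_buyers_sellers[OF feas] by (simp only: right_diff_distrib)
  qed
  also have "\<dots> = expect K (\<lambda>(v, c). \<Sum>i\<in>buyers K. if i \<in> fst ` X (v, c) then virt \<alpha> i (v i) else 0)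
      - expect K ?S"
    unfolding expect_virtual_value[OF X, symmetric] by (rule expect_diff)
  also have "\<dots> = expect K (\<lambda>t. (case t of (v, c) \<Rightarrow>
      (\<Sum>i\<in>buyers K. if i \<in> fst ` X (v, c) then virt \<alpha> i (v i) else 0)) - ?S t)"
    by (rule expect_diff[symmetric])
  also have "\<dots> = expect K (\<lambda>(v, c). surplus (virts \<alpha> v) c (X (v, c)) -
    \<alpha> * (\<Sum>j\<in>sellers K. if j \<in> snd ` X (v, c) then Max (accepted_costs X v c j) - c j else 0))"
  proof (rule expect_cong)
    fix v c
    have "?S (v, c) = (\<Sum>j\<in>sellers K. if j \<in> snd ` X (v, c) then c j else 0) +
      \<alpha> * (\<Sum>j\<in>sellers K. if j \<in> snd ` X (v, c) then Max (accepted_costs X v c j) - c j else 0)"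
      unfolding sum_distrib_left sum.distrib[symmetric] prod.case
      by (rule sum.cong) (auto simp: algebra_simps)
    then show "(case (v, c) of (v, c) \<Rightarrow>
      (\<Sum>i\<in>buyers K. if i \<in> fst ` X (v, c) then virt \<alpha> i (v i) else 0)) - ?S (v, c) =
      (case (v, c) of (v, c) \<Rightarrow> surplus (virts \<alpha> v) c (X (v, c)) -
    \<alpha> * (\<Sum>j\<in>sellers K. if j \<in> snd ` X (v, c) then Max (accepted_costs X v c j) - c j else 0))"
      unfolding prod.case surplus_buyers_sellers[OF feas] virts_def by simp
  qed
  finally show ?thesis .
qed

lemma monotone_trim:
  assumes "0 \<le> \<alpha>"
  shows "monotone_rule (\<lambda>(v, c). trim s (virts \<alpha> v) c)"
  unfolding monotone_rule_def
proof (intro conjI allI ballI, goal_cases)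
  case (1 t)
  then show ?case by (simp add: case_prod_unfold trim_feasible)
next
  case (2 t)
  obtain v c where t: "t = (v, c)" by (cases t)
  note vc = 2[unfolded t]
  have "i \<in> fst ` trim s (virts \<alpha> (v(i := r))) c"
    if i: "i \<in> fst ` trim s (virts \<alpha> v) c" and r: "r \<in> set_pmf (value_prior K i)" "v i \<le> r" for i r
  proof -
    have ib: "i \<in> buyers K" using i feasible_fst[OF trim_feasible] by blast
    have "virts \<alpha> v i \<le> virt \<alpha> i r"
      unfolding virts_def by (rule virt_mono[OF ib assms r(2) profile_value[OF vc ib] r(1)])
    then show ?thesis unfolding virts_upd by (rule trim_raise_value[OF i])
  qed
  moreover have "j \<in> snd ` trim s (virts \<alpha> v) (c(j := r))"
    if "j \<in> snd ` trim s (virts \<alpha> v) c" "r \<in> set_pmf (cost_prior K j)" "r \<le> c j" for j r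
    using trim_lower_cost[OF that(1,3,2)] .
  ultimately show ?case unfolding t prod.case by blast
qed

lemma accepted_costs_trim:
  "accepted_costs (\<lambda>(v, c). trim s (virts \<alpha> v) c) v c j = core s (standing (virts \<alpha> v) c j)"
proof -
  have "core s (standing (virts \<alpha> v) c j) \<subseteq> set_pmf (cost_prior K j)"
    using core_subset[of s "standing (virts \<alpha> v) c j"] by (auto simp: standing_def)
  then show ?thesis by (auto simp: accepted_costs_def seller_in_trim)
qed

definition welfare :: "real \<Rightarrow> nat \<Rightarrow> real" where
  "welfare \<alpha> s = expect K (\<lambda>(v, c). surplus (virts \<alpha> v) c (trim s (virts \<alpha> v) c))"

lemma lagrangian_trim:
  assumes "0 \<le> \<alpha>"
  shows "welfare \<alpha> s \<le> lagrangian \<alpha> (threshold_mechanism (\<lambda>(v, c). trim s (virts \<alpha> v) c)) +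
    \<alpha> * welfare \<alpha> (Suc s)"
proof -
  let ?R = "\<lambda>(v, c). \<Sum>j\<in>sellers K. if j \<in> snd ` trim s (virts \<alpha> v) c
    then Max (core s (standing (virts \<alpha> v) c j)) - c j else 0"
  have "lagrangian \<alpha> (threshold_mechanism (\<lambda>(v, c). trim s (virts \<alpha> v) c)) =
      expect K (\<lambda>t. (case t of (v, c) \<Rightarrow> surplus (virts \<alpha> v) c (trim s (virts \<alpha> v) c)) - \<alpha> * ?R t)"
    unfolding lagrangian_threshold[OF monotone_trim[OF assms]] accepted_costs_trim
    by (rule expect_cong) simp
  also have "\<dots> = welfare \<alpha> s - \<alpha> * expect K ?R"
    unfolding welfare_def by (subst expect_diff) simp
  finally have "lagrangian \<alpha> (threshold_mechanism (\<lambda>(v, c). trim s (virts \<alpha> v) c)) =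
    welfare \<alpha> s - \<alpha> * expect K ?R" .
  moreover have "expect K ?R \<le> welfare \<alpha> (Suc s)"
    unfolding welfare_def
    by (rule expect_mono) (use seller_rent_trim profile_cost in \<open>simp only: prod.case\<close>)
  ultimately show ?thesis using mult_left_mono[OF _ assms, of "expect K ?R" "welfare \<alpha> (Suc s)"] by linarith
qed

lemma welfare_sum:
  assumes "0 \<le> \<alpha>"
  shows "welfare \<alpha> 0 \<le> (\<Sum>s<n. \<alpha> ^ s *
    lagrangian \<alpha> (threshold_mechanism (\<lambda>(v, c). trim s (virts \<alpha> v) c))) + \<alpha> ^ n * welfare \<alpha> n"
proof (induction n)
  case (Suc n)
  have "\<alpha> ^ n * welfare \<alpha> n \<le> \<alpha> ^ n * (lagrangian \<alpha> (threshold_mechanism (\<lambda>(v, c). trim n (virts \<alpha> v) c)) +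
    \<alpha> * welfare \<alpha> (Suc n))"
    by (rule mult_left_mono[OF lagrangian_trim[OF assms]]) (use assms in simp)
  with Suc show ?case by (simp add: algebra_simps)
qed simp

lemma welfare_0: "welfare \<alpha> 0 = expect K (\<lambda>(v, c). surplus (virts \<alpha> v) c (best (virts \<alpha> v) c))"
  unfolding welfare_def by (rule expect_cong) (simp add: trim_0 profile_cost)

lemma welfare_vanishes:
  assumes "\<And>j. j \<in> sellers K \<Longrightarrow> card (set_pmf (cost_prior K j)) \<le> m"
  shows "welfare \<alpha> m = 0"
  using trim_empty[OF assms] by (simp add: welfare_def surplus_def case_prod_unfold)

text \<open>Trades of high-value buyers that would persist at their low value: the revenue of this rule
  covers the information rents of the buyers in the efficient allocation.\<close>

definition high_only :: "('b, 's) profile \<Rightarrow> ('b \<times> 's) set" where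
  "high_only = (\<lambda>(v, c). {(i, j) \<in> best v c. v i = high i \<and> i \<in> fst ` best (v(i := low i)) c})"

lemma high_only_feasible: "high_only t \<in> feasible K"
  by (rule feasible_mono[OF best_feasible[of "fst t" "snd t"]]) (auto simp: high_only_def)

lemma best_low:
  assumes "(v, c) \<in> set_pmf (profiles K)" "i \<in> fst ` best (v(i := low i)) c"
  shows "best (v(i := low i)) c = best v c"
proof -
  have i: "i \<in> buyers K" using assms(2) feasible_fst[OF best_feasible] by blast
  have "low i \<le> v i" using profile_value[OF assms(1) i] buyer_types[OF i] by auto
  then have "best ((v(i := low i))(i := v i)) c = best (v(i := low i)) c"
    by (intro best_raise_value[OF assms(2)]) simp
  then show ?thesis by simp
qed

lemma buyer_in_high_only:
  assumes "(v, c) \<in> set_pmf (profiles K)"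
  shows "i \<in> fst ` high_only (v, c) \<longleftrightarrow> v i = high i \<and> i \<in> fst ` best (v(i := low i)) c"
  using best_low[OF assms, of i] by (force simp: high_only_def)

lemma monotone_high_only: "monotone_rule high_only"
  unfolding monotone_rule_def
proof (intro conjI allI ballI, goal_cases)
  case (1 t)
  then show ?case by (rule high_only_feasible)
next
  case (2 t)
  obtain v c where t: "t = (v, c)" by (cases t)
  note vc = 2[unfolded t]
  have "i \<in> fst ` high_only (v(i := r), c)"
    if i: "i \<in> fst ` high_only (v, c)" and r: "r \<in> set_pmf (value_prior K i)" "v i \<le> r" for i r
  proof -
    have ib: "i \<in> buyers K" using i feasible_fst[OF high_only_feasible] by blast
    \<comment> \<open>A buyer who trades under this rule already has her highest value, so no proper
      raise exists.\<close>
    have "v i = high i" using i buyer_in_high_only[OF vc] by simp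
    then have "r = v i" using r buyer_types[OF ib] by auto
    then show ?thesis using i by simp
  qed
  moreover have "j \<in> snd ` high_only (v, c(j := r))"
    if j: "j \<in> snd ` high_only (v, c)" and r: "r \<le> c j" for j r
  proof -
    obtain i where "(i, j) \<in> high_only (v, c)" using j by auto
    then have i: "(i, j) \<in> best v c" "v i = high i" "i \<in> fst ` best (v(i := low i)) c"
      by (simp_all add: high_only_def)
    \<comment> \<open>The optimal matchings at the actual and at the low value of \<open>i\<close>
      both contain \<open>j\<close>, so both survive a lower cost of \<open>j\<close>.\<close>
    have "best (v(i := low i)) c = best v c" using best_low[OF vc i(3)] .
    then have "j \<in> snd ` best (v(i := low i)) c" "j \<in> snd ` best v c" using i(1) by force+
    then have "best v (c(j := r)) = best v c" "best (v(i := low i)) (c(j := r)) = best (v(i := low i)) c"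
      using r by (simp_all add: best_lower_cost)
    then have "(i, j) \<in> high_only (v, c(j := r))"
      using i by (simp add: high_only_def)
    then show ?thesis by force
  qed
  ultimately show ?case unfolding t prod.case by blast
qed

text \<open>At every accepted cost the partner of \<open>j\<close> is still \<open>i\<close>, and
  the pair stays matched when \<open>i\<close> is lowered to \<open>low i\<close>;
  \<open>best_edge_nonneg\<close> then bounds the cost.\<close>

lemma high_only_cost_bound:
  assumes vc: "(v, c) \<in> set_pmf (profiles K)" and ij: "(i, j) \<in> high_only (v, c)"
  shows "Max (accepted_costs high_only v c j) \<le> low i"
proof -
  have j: "j \<in> sellers K" "(i, j) \<in> best v c"
    using ij feasible_subset[OF best_feasible] by (auto simp: high_only_def)
  have "c j \<in> accepted_costs high_only v c j"
    using ij profile_cost[OF vc j(1)] by (force simp: accepted_costs_def)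
  moreover have "r \<le> low i" if r: "r \<in> accepted_costs high_only v c j" for r
  proof -
    have rT: "r \<in> set_pmf (cost_prior K j)" using r by (simp add: accepted_costs_def)
    obtain i' where "(i', j) \<in> high_only (v, c(j := r))"
      using r by (auto simp: accepted_costs_def)
    then have i': "(i', j) \<in> best v (c(j := r))" "i' \<in> fst ` best (v(i' := low i')) (c(j := r))"
      by (simp_all add: high_only_def)
    have "best v (c(j := c j)) = best v (c(j := r))"
      by (rule best_same_cost) (use j(2) i'(1) in force)+
    then have "i' = i"
      using matching_snd_unique[OF best_feasible] i'(1) j(2) by simp
    moreover have "best (v(i' := low i')) (c(j := r)) = best v (c(j := r))"
      using best_low[OF profile_upd_cost[OF vc j(1) rT] i'(2)] .
    ultimately have "(i, j) \<in> best (v(i := low i)) (c(j := r))" using i'(1) by simp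
    from best_edge_nonneg[OF this] show ?thesis by simp
  qed
  moreover have "finite (accepted_costs high_only v c j)"
    using finite_costs[OF j(1)] by (simp add: accepted_costs_def)
  ultimately show ?thesis by (subst Max_le_iff) auto
qed

text \<open>On each traded edge the buyer pays \<open>high i\<close>, since her low value is never
  accepted, and the seller receives at most \<open>low i\<close>.\<close>

lemma revenue_high_only:
  "expect K (\<lambda>(v, c). \<Sum>i\<in>buyers K. if v i = high i \<and> i \<in> fst ` best (v(i := low i)) c
      then high i - low i else 0) \<le> revenue (threshold_mechanism high_only)"
  unfolding threshold_revenue
proof (rule expect_mono, unfold prod.case)
  fix v c assume vc: "(v, c) \<in> set_pmf (profiles K)"
  let ?M = "high_only (v, c)"
  have inj: "inj_on fst ?M" "inj_on snd ?M"
    using feasible_matching[OF high_only_feasible] unfolding is_matching_def by auto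
  have "(\<Sum>j\<in>sellers K. if j \<in> snd ` ?M then Max (accepted_costs high_only v c j) else 0) =
      (\<Sum>j\<in>snd ` ?M. Max (accepted_costs high_only v c j))"
    by (subst sum.inter_restrict[symmetric])
      (use feasible_snd[OF high_only_feasible] in \<open>auto simp: Int_absorb1\<close>)
  also have "\<dots> = (\<Sum>e\<in>?M. Max (accepted_costs high_only v c (snd e)))"
    using inj by (subst sum.reindex) auto
  also have "\<dots> \<le> (\<Sum>e\<in>?M. low (fst e))"
    by (rule sum_mono) (use high_only_cost_bound[OF vc] in auto)
  also have "\<dots> = (\<Sum>i\<in>fst ` ?M. low i)"
    using inj by (subst sum.reindex) auto
  also have "\<dots> = (\<Sum>i\<in>buyers K. if i \<in> fst ` ?M then low i else 0)"
    by (subst sum.inter_restrict[symmetric])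
      (use feasible_fst[OF high_only_feasible] in \<open>auto simp: Int_absorb1\<close>)
  finally have sellers: "(\<Sum>j\<in>sellers K. if j \<in> snd ` ?M then Max (accepted_costs high_only v c j) else 0) \<le>
      (\<Sum>i\<in>buyers K. if i \<in> fst ` ?M then low i else 0)" .
  have "(\<Sum>i\<in>buyers K. if i \<in> fst ` ?M then Min (accepted_values high_only v c i) else 0) =
      (\<Sum>i\<in>buyers K. if i \<in> fst ` ?M then high i else 0)"
  proof (rule sum.cong[OF refl])
    fix i assume i: "i \<in> buyers K"
    have "i \<notin> fst ` high_only (v(i := low i), c)"
      using buyer_types(2)[OF i] by (auto simp: high_only_def)
    then show "(if i \<in> fst ` ?M then Min (accepted_values high_only v c i) else 0) =
        (if i \<in> fst ` ?M then high i else 0)"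
      using min_accepted_values[OF monotone_high_only vc i] by simp
  qed
  moreover have "(\<Sum>i\<in>buyers K. if v i = high i \<and> i \<in> fst ` best (v(i := low i)) c then high i - low i else 0)
    = (\<Sum>i\<in>buyers K. if i \<in> fst ` ?M then high i else 0) - (\<Sum>i\<in>buyers K. if i \<in> fst ` ?M then low i else 0)"
    unfolding buyer_in_high_only[OF vc] sum_subtractf[symmetric] by (rule sum.cong) auto
  ultimately show "(\<Sum>i\<in>buyers K. if v i = high i \<and> i \<in> fst ` best (v(i := low i)) c then high i - low i else 0)
    \<le> (\<Sum>i\<in>buyers K. if i \<in> fst ` ?M then Min (accepted_values high_only v c i) else 0) -
      (\<Sum>j\<in>sellers K. if j \<in> snd ` ?M then Max (accepted_costs high_only v c j) else 0)"
    using sellers by linarith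
qed

text \<open>The efficient matching competes in the virtual problem and loses there only the odds
  terms of trading low-value buyers. \<open>expect_swap\<close> turns these into rents of high-value
  buyers, which \<open>revenue_high_only\<close> bounds.\<close>

lemma FB_virtual:
  assumes "0 \<le> \<alpha>"
  shows "FB K \<le> welfare \<alpha> 0 + \<alpha> * revenue (threshold_mechanism high_only)"
proof -
  define L where "L i = (\<lambda>(v, c). (if v i = low i then odds i else 0) *
    (if i \<in> fst ` best (fst (v(i := low i), c)) (snd (v(i := low i), c)) then 1 else 0 :: real))" for i
  define H where "H i = (\<lambda>(v, c). (if v i = high i then 1 else 0) *
    (if i \<in> fst ` best (fst (v(i := low i), c)) (snd (v(i := low i), c)) then 1 else 0 :: real))" for i
  have LH: "expect K (L i) = expect K (H i)" if "i \<in> buyers K" for i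
    unfolding L_def H_def
    by (rule expect_swap[OF that, of "\<lambda>t. if i \<in> fst ` best (fst t) (snd t) then 1 else 0"])
  have "FB K \<le> expect K (\<lambda>t. (case t of (v, c) \<Rightarrow> surplus (virts \<alpha> v) c (best (virts \<alpha> v) c)) +
      \<alpha> * (\<Sum>i\<in>buyers K. (high i - low i) * L i t))"
    unfolding FB_best
  proof (rule expect_mono, unfold prod.case)
    fix v c assume vc: "(v, c) \<in> set_pmf (profiles K)"
    have "surplus v c (best v c) - surplus (virts \<alpha> v) c (best v c) =
        (\<Sum>i\<in>buyers K. if i \<in> fst ` best v c then v i - virts \<alpha> v i else 0)"
      unfolding surplus_buyers_sellers[OF best_feasible] by (simp add: sum_subtractf[symmetric] if_distrib cong: if_cong)
    also have "\<dots> = (\<Sum>i\<in>buyers K. \<alpha> * ((high i - low i) * L i (v, c)))"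
    proof (rule sum.cong[OF refl])
      fix i
      show "(if i \<in> fst ` best v c then v i - virts \<alpha> v i else 0) = \<alpha> * ((high i - low i) * L i (v, c))"
      proof (cases "v i = low i")
        case True
        then have "v(i := low i) = v" by (metis fun_upd_triv)
        then show ?thesis using True by (simp add: L_def virts_def virt_def)
      qed (simp add: L_def virts_def virt_def)
    qed
    also have "\<dots> = \<alpha> * (\<Sum>i\<in>buyers K. (high i - low i) * L i (v, c))"
      by (simp add: sum_distrib_left)
    finally show "surplus v c (best v c) \<le> surplus (virts \<alpha> v) c (best (virts \<alpha> v) c) +
        \<alpha> * (\<Sum>i\<in>buyers K. (high i - low i) * L i (v, c))"
      using best_max[OF best_feasible, of "virts \<alpha> v" c v c] by linarith
  qed
  also have "\<dots> = welfare \<alpha> 0 + \<alpha> * (\<Sum>i\<in>buyers K. (high i - low i) * expect K (L i))"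
    unfolding welfare_0 by simp
  also have "(\<Sum>i\<in>buyers K. (high i - low i) * expect K (L i)) =
      expect K (\<lambda>t. \<Sum>i\<in>buyers K. (high i - low i) * H i t)"
    by (simp add: LH)
  also have "\<dots> = expect K (\<lambda>(v, c). \<Sum>i\<in>buyers K.
      if v i = high i \<and> i \<in> fst ` best (v(i := low i)) c then high i - low i else 0)"
    by (rule expect_cong) (auto simp: H_def intro!: sum.cong)
  also have "welfare \<alpha> 0 + \<alpha> * \<dots> \<le> welfare \<alpha> 0 + \<alpha> * revenue (threshold_mechanism high_only)"
    by (intro add_left_mono mult_left_mono[OF revenue_high_only assms])
  finally show ?thesis .
qed

text \<open>Trading buyers pay at most their values and trading sellers receive at least their
  costs.\<close>

lemma revenue_le_GFT:
  assumes X: "monotone_rule X"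
  shows "revenue (threshold_mechanism X) \<le> GFT K (threshold_mechanism X)"
  unfolding threshold_revenue threshold_GFT[OF monotone_rule_feasible[OF X]]
    surplus_buyers_sellers[OF monotone_rule_feasible[OF X]]
proof (rule expect_mono, unfold prod.case)
  fix v c assume vc: "(v, c) \<in> set_pmf (profiles K)"
  show "(\<Sum>i\<in>buyers K. if i \<in> fst ` X (v, c) then Min (accepted_values X v c i) else 0) -
      (\<Sum>j\<in>sellers K. if j \<in> snd ` X (v, c) then Max (accepted_costs X v c j) else 0)
    \<le> (\<Sum>i\<in>buyers K. if i \<in> fst ` X (v, c) then v i else 0) -
      (\<Sum>j\<in>sellers K. if j \<in> snd ` X (v, c) then c j else 0)"
    by (intro diff_mono sum_mono)
      (use threshold_accepts_value[OF X vc] threshold_accepts_cost[OF X vc] in auto)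
qed

text \<open>The Lagrangians of the trimmed rules with weights \<open>\<alpha> ^ s\<close> and of
  \<open>high_only\<close> with weight \<alpha> add up to at least \<open>FB K\<close>; the best of
  these candidates is taken.\<close>

lemma lagrangian_bound:
  assumes "0 \<le> \<alpha>" "\<alpha> \<le> 1" "m \<ge> 1"
    and m: "\<And>j. j \<in> sellers K \<Longrightarrow> card (set_pmf (cost_prior K j)) \<le> m"
  shows "\<exists>A. admissible A \<and> FB K \<le> ((\<Sum>s<m. \<alpha> ^ s) + \<alpha>) * lagrangian \<alpha> A"
proof -
  let ?T = "\<lambda>s. threshold_mechanism (\<lambda>(v, c). trim s (virts \<alpha> v) c)"
  let ?H = "threshold_mechanism high_only"
  let ?S = "insert ?H (?T ` {..<m})"
  define l where "l = Max (lagrangian \<alpha> ` ?S)"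
  have "l \<in> lagrangian \<alpha> ` ?S" unfolding l_def by (rule Max_in) auto
  then obtain A where A: "A \<in> ?S" "lagrangian \<alpha> A = l" by blast
  have le: "lagrangian \<alpha> B \<le> l" if "B \<in> ?S" for B
    unfolding l_def using that by (intro Max_ge) auto
  \<comment> \<open>As revenue is at most the gains from trade, the Lagrangian, a convex combination
    of the two, is at least the revenue.\<close>
  have "\<alpha> * revenue ?H \<le> \<alpha> * revenue ?H + (1 - \<alpha>) * (GFT K ?H - revenue ?H) * \<alpha>"
    using assms(1,2) revenue_le_GFT[OF monotone_high_only] by simp
  also have "\<dots> \<le> \<alpha> * lagrangian \<alpha> ?H"
    by (simp add: lagrangian_def algebra_simps)
  also have "\<dots> \<le> \<alpha> * l" using le[of ?H] assms(1) by (intro mult_left_mono) auto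
  finally have H: "\<alpha> * revenue ?H \<le> \<alpha> * l" .
  have "welfare \<alpha> 0 \<le> (\<Sum>s<m. \<alpha> ^ s * lagrangian \<alpha> (?T s))"
    using welfare_sum[OF assms(1), of m] welfare_vanishes[OF m] by simp
  also have "\<dots> \<le> (\<Sum>s<m. \<alpha> ^ s * l)"
    using le assms(1) by (intro sum_mono mult_left_mono) auto
  finally have "FB K \<le> ((\<Sum>s<m. \<alpha> ^ s) + \<alpha>) * lagrangian \<alpha> A"
    using FB_virtual[OF assms(1)] H A(2) by (simp add: sum_distrib_right distrib_right)
  moreover have "admissible A"
    using A(1) threshold_admissible monotone_trim[OF assms(1)] monotone_high_only by auto
  ultimately show ?thesis by blast
qed

end

subsection \<open>Mixing mechanisms\<close>

lemma measure_bernoulli_bind: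
  assumes "0 \<le> p" "p \<le> 1"
  shows "measure (measure_pmf (bernoulli_pmf p \<bind> f)) S =
    p * measure (measure_pmf (f True)) S + (1 - p) * measure (measure_pmf (f False)) S"
proof -
  have "emeasure (measure_pmf (bernoulli_pmf p \<bind> f)) S =
      ennreal p * emeasure (measure_pmf (f True)) S + ennreal (1 - p) * emeasure (measure_pmf (f False)) S"
    using assms by (simp add: mult.commute)
  then have "ennreal (measure (measure_pmf (bernoulli_pmf p \<bind> f)) S) =
      ennreal (p * measure (measure_pmf (f True)) S + (1 - p) * measure (measure_pmf (f False)) S)"
    using assms by (simp add: measure_pmf.emeasure_eq_measure ennreal_mult ennreal_plus)
  then show ?thesis
    using assms by (subst (asm) ennreal_inj) (auto intro!: add_nonneg_nonneg)
qed

lemma sum_convex_combination: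
  fixes f g :: "'a \<Rightarrow> real"
  shows "(\<Sum>x\<in>A. p * f x + (1 - p) * g x) = p * sum f A + (1 - p) * sum g A"
  by (simp add: sum.distrib sum_distrib_left)

text \<open>Payments are deterministic functions of the reports, so they are averaged while the
  allocation is randomised. Utilities are linear in both and become convex combinations.\<close>

definition mix :: "real \<Rightarrow> ('b, 's) mechanism \<Rightarrow> ('b, 's) mechanism \<Rightarrow> ('b, 's) mechanism" where
  "mix p A B = \<lparr>alloc = (\<lambda>t. bernoulli_pmf p \<bind> (\<lambda>b. if b then alloc A t else alloc B t)),
     buyer_pay = (\<lambda>t i. p * buyer_pay A t i + (1 - p) * buyer_pay B t i),
     seller_pay = (\<lambda>t j. p * seller_pay A t j + (1 - p) * seller_pay B t j)\<rparr>"

lemma pay_mix: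
  "buyer_pay (mix p A B) t i = p * buyer_pay A t i + (1 - p) * buyer_pay B t i"
  "seller_pay (mix p A B) t j = p * seller_pay A t j + (1 - p) * seller_pay B t j"
  by (simp_all add: mix_def)

context finite_market
begin

context
  fixes p :: real
  assumes p: "0 \<le> p" "p \<le> 1"
begin

lemma edge_prob_mix: "edge_prob (mix p A B) t i j = p * edge_prob A t i j + (1 - p) * edge_prob B t i j"
  using p by (simp add: edge_prob_def mix_def measure_bernoulli_bind)

lemma expect_mix: "expect K (\<lambda>t. p * f t + (1 - p) * g t) = p * expect K f + (1 - p) * expect K g"
  by simp

lemma buyer_util_mix: "buyer_util K (mix p A B) i x r = p * buyer_util K A i x r + (1 - p) * buyer_util K B i x r"
  unfolding buyer_util_def expect_mix[symmetric] buyer_prob_def edge_prob_mix pay_mix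
    sum_convex_combination
  by (rule expect_cong) (simp add: algebra_simps)

lemma seller_util_mix: "seller_util K (mix p A B) j x r = p * seller_util K A j x r + (1 - p) * seller_util K B j x r"
  unfolding seller_util_def expect_mix[symmetric] seller_prob_def edge_prob_mix pay_mix
    sum_convex_combination
  by (rule expect_cong) (simp add: algebra_simps)

lemma GFT_mix: "GFT K (mix p A B) = p * GFT K A + (1 - p) * GFT K B"
  unfolding GFT_def expect_mix[symmetric] edge_prob_mix
  by (rule expect_cong)
    (simp add: sum_distrib_left sum.distrib[symmetric] case_prod_unfold algebra_simps)

lemma revenue_mix: "revenue (mix p A B) = p * revenue A + (1 - p) * revenue B"
  unfolding revenue_def expect_mix[symmetric] pay_mix sum_convex_combination
  by (rule expect_cong) (simp add: algebra_simps)

lemma admissible_mix: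
  assumes "admissible A" "admissible B"
  shows "admissible (mix p A B)"
proof -
  have "is_mechanism K (mix p A B)"
    using assms unfolding admissible_def is_mechanism_def mix_def by (fastforce split: if_splits)
  moreover have "BIC K (mix p A B)"
    using assms p unfolding BIC_def admissible_def buyer_util_mix seller_util_mix
    by (auto intro!: add_mono mult_left_mono)
  moreover have "IIR K (mix p A B)"
    using assms p unfolding IIR_def admissible_def buyer_util_mix seller_util_mix
    by auto
  ultimately show ?thesis by (simp add: admissible_def)
qed

end

section \<open>Separation in the plane of gains and revenue\<close>

lemma convex_outcomes: "convex {(GFT K A, revenue A) | A. admissible A}"
  unfolding convex_alt
proof (intro ballI allI impI)
  fix x y and u :: real
  assume x: "x \<in> {(GFT K A, revenue A) | A. admissible A}"
    and y: "y \<in> {(GFT K A, revenue A) | A. admissible A}" and u: "0 \<le> u \<and> u \<le> 1"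
  obtain A B where "x = (GFT K A, revenue A)" "y = (GFT K B, revenue B)" "admissible A" "admissible B"
    using x y by blast
  then have "(1 - u) *\<^sub>R x + u *\<^sub>R y = (GFT K (mix u B A), revenue (mix u B A))" "admissible (mix u B A)"
    using u by (simp_all add: GFT_mix revenue_mix admissible_mix)
  then show "(1 - u) *\<^sub>R x + u *\<^sub>R y \<in> {(GFT K A, revenue A) | A. admissible A}"
    by blast
qed

definition no_trade :: "('b, 's) mechanism" where
  "no_trade = threshold_mechanism (\<lambda>_. {})"

lemma no_trade: "admissible no_trade" "GFT K no_trade = 0" "revenue no_trade = 0"
proof -
  have "monotone_rule (\<lambda>_. {})" by (auto simp: monotone_rule_def empty_feasible)
  then show "admissible no_trade" unfolding no_trade_def by (rule threshold_admissible)
qed (simp_all add: no_trade_def threshold_GFT empty_feasible threshold_revenue surplus_def case_prod_unfold)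

lemma SB_altdef: "SB K = Sup {GFT K A | A. admissible A \<and> 0 \<le> revenue A}"
  by (simp add: SB_def admissible_def ex_ante_WBB_def revenue_def conj_assoc)

text \<open>A bound uniform in the mechanism, which makes the set under the supremum in
  \<open>SB\<close> bounded above.\<close>

lemma GFT_bound: "GFT K A \<le> expect K (\<lambda>(v, c). \<Sum>(i, j)\<in>edges K. \<bar>v i - c j\<bar>)"
proof -
  have "x * edge_prob A t i j \<le> \<bar>x\<bar>" for x t i j
  proof -
    have "x * edge_prob A t i j \<le> \<bar>x\<bar> * edge_prob A t i j"
      by (rule mult_right_mono) (auto simp: edge_prob_def)
    also have "\<dots> \<le> \<bar>x\<bar> * 1"
      by (rule mult_left_mono) (auto simp: edge_prob_def)
    finally show ?thesis by simp
  qed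
  then show ?thesis
    unfolding GFT_def by (intro expect_mono) (auto intro!: sum_mono)
qed

lemma GFT_le_SB:
  assumes "admissible A" "0 \<le> revenue A"
  shows "GFT K A \<le> SB K"
  unfolding SB_altdef using assms GFT_bound
  by (intro cSup_upper bdd_aboveI[of _ "expect K (\<lambda>(v, c). \<Sum>(i, j)\<in>edges K. \<bar>v i - c j\<bar>)"]) auto

lemma SB_le:
  assumes "\<And>A. admissible A \<Longrightarrow> 0 \<le> revenue A \<Longrightarrow> GFT K A \<le> b"
  shows "SB K \<le> b"
  unfolding SB_altdef using assms no_trade by (intro cSup_least) (auto intro!: exI[of _ no_trade])

lemma FB_nonneg: "0 \<le> FB K"
  unfolding FB_best
proof (rule expect_nonneg, unfold prod.case)
  fix v c
  show "0 \<le> surplus v c (best v c)"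
    using best_max[OF empty_feasible, of v c] by (simp add: surplus_def)
qed

text \<open>If no outcome lay in the quadrant with corner \<open>(b - e, 0)\<close>, a separating
  normal, scaled to \<open>(1 - \<alpha>, \<alpha>)\<close>, would contradict \<open>dual\<close>.
  The slack \<open>e\<close> compensates for separation being weak; at \<alpha> = 1 it has no
  weight, hence the demand for strictly positive revenue.\<close>

lemma SB_ge_dual:
  assumes "0 < b"
    and dual: "\<And>\<alpha>. 0 \<le> \<alpha> \<Longrightarrow> \<alpha> \<le> 1 \<Longrightarrow> \<exists>A. admissible A \<and> (1 - \<alpha>) * b \<le> (1 - \<alpha>) * GFT K A + \<alpha> * revenue A
      \<and> (1 - \<alpha> = 0 \<longrightarrow> 0 < revenue A)"
  shows "b \<le> SB K"
proof (rule field_le_epsilon)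
  fix e :: real assume e: "0 < e"
  let ?P = "{(GFT K A, revenue A) | A. admissible A}"
  let ?Q = "{b - e..} \<times> {0 :: real..}"
  have "?P \<inter> ?Q \<noteq> {}"
  proof
    assume disj: "?P \<inter> ?Q = {}"
    have "convex ?Q" by (intro convex_Times convex_real_interval)
    moreover have "?P \<noteq> {}" using no_trade(1) by blast
    moreover have "?Q \<noteq> {}" by auto
    ultimately obtain a d where a: "a \<noteq> 0" "\<And>x. x \<in> ?P \<Longrightarrow> a \<bullet> x \<le> d" "\<And>x. x \<in> ?Q \<Longrightarrow> d \<le> a \<bullet> x"
      using separating_hyperplane_sets[OF convex_outcomes, of ?Q] disj by blast
    obtain y z where yz: "a = (y, z)" by (cases a)
    have P: "y * GFT K A + z * revenue A \<le> d" if "admissible A" for A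
      using a(2)[of "(GFT K A, revenue A)"] that yz by auto
    have Q: "d \<le> y * g + z * r" if "b - e \<le> g" "0 \<le> r" for g r
      using a(3)[of "(g, r)"] that yz by auto
    \<comment> \<open>A negative coefficient would push the functional below its lower bound
      \<open>d\<close> along an unbounded side of the quadrant; the witness brings it to at most
      \<open>d - 1\<close>. The argument for \<open>z\<close> is the same.\<close>
    have "0 \<le> y"
    proof (rule ccontr)
      assume "\<not> 0 \<le> y"
      then show False
        using Q[of "max (b - e) ((d - 1) / y)" 0] P[OF no_trade(1)] no_trade(2,3)
          mult_left_mono_neg[of "(d - 1) / y" "max (b - e) ((d - 1) / y)" y] by simp
    qed
    moreover have "0 \<le> z"
    proof (rule ccontr)
      assume z: "\<not> 0 \<le> z"
      define r where "r = max 0 ((d - 1 - y * (b - e)) / z)"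
      have "z * r \<le> z * ((d - 1 - y * (b - e)) / z)"
        using z unfolding r_def by (intro mult_left_mono_neg) auto
      then show False
        using Q[of "b - e" r] z by (simp add: r_def)
    qed
    moreover have "y \<noteq> 0 \<or> z \<noteq> 0" using a(1) yz by (auto simp: zero_prod_def)
    ultimately have pos: "0 < y + z" "0 \<le> y" "0 \<le> z" by auto
    define \<alpha> where "\<alpha> = z / (y + z)"
    have \<alpha>: "0 \<le> \<alpha>" "\<alpha> \<le> 1" using pos by (simp_all add: \<alpha>_def)
    have y: "y = (y + z) * (1 - \<alpha>)" and z: "z = (y + z) * \<alpha>"
      using pos(1) by (simp_all add: \<alpha>_def field_simps)
    obtain A where A: "admissible A" "(1 - \<alpha>) * b \<le> (1 - \<alpha>) * GFT K A + \<alpha> * revenue A"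
      "1 - \<alpha> = 0 \<Longrightarrow> 0 < revenue A"
      using dual[OF \<alpha>] by blast
    have "y * GFT K A + z * revenue A \<le> y * (b - e)"
      using P[OF A(1)] Q[of "b - e" 0] by simp
    then have "(y + z) * ((1 - \<alpha>) * GFT K A + \<alpha> * revenue A) \<le> (y + z) * ((1 - \<alpha>) * (b - e))"
      by (subst (asm) (1 2) y, subst (asm) z) (simp add: algebra_simps)
    then have le: "(1 - \<alpha>) * GFT K A + \<alpha> * revenue A \<le> (1 - \<alpha>) * (b - e)"
      using pos(1) by simp
    then show False
    proof (cases "\<alpha> = 1")
      case True
      then show False using le A(3) by simp
    next
      case False
      then have "0 < (1 - \<alpha>) * e" using \<alpha> e by simp
      then show False using le A(2) by (simp add: algebra_simps)
    qed
  qed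
  then obtain A where "admissible A" "b - e \<le> GFT K A" "0 \<le> revenue A" by auto
  then show "b \<le> SB K + e" using GFT_le_SB[of A] by linarith
qed

end

subsection \<open>The factor\<close>

definition dual_value :: "nat \<Rightarrow> real \<Rightarrow> real" where
  "dual_value m q = 1 + q - q ^ 2 - q ^ m"

lemma dual_value_eq: "dual_value m q = (1 - q) * ((\<Sum>s<m. q ^ s) + q)"
  using one_diff_power_eq[of q m] by (simp add: dual_value_def algebra_simps power2_eq_square)

lemma dual_value_le:
  assumes "q \<in> {0..<1}"
  shows "dual_value m q \<le> 5 / 4"
proof -
  have "0 \<le> q ^ m" using assms by simp
  then show ?thesis
    using sum_squares_bound[of q "1 / 2"] by (simp add: dual_value_def power2_eq_square)
qed

lemma bdd_dual_value: "bdd_above (dual_value m ` {0..<1})"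
  using dual_value_le by (intro bdd_aboveI[of _ "5 / 4"]) auto

lemma sb_factor_eq: "sb_factor m = inverse (SUP q\<in>{0..<1}. dual_value m q)"
  by (simp add: sb_factor_def dual_value_def)

lemma dual_value_le_Sup: "q \<in> {0..<1} \<Longrightarrow> dual_value m q \<le> (SUP q\<in>{0..<1}. dual_value m q)"
  by (rule cSUP_upper[OF _ bdd_dual_value])

lemma Sup_dual_value_ge_1: "m \<ge> 1 \<Longrightarrow> 1 \<le> (SUP q\<in>{0..<1}. dual_value m q)"
  using dual_value_le_Sup[of 0 m] by (simp add: dual_value_def power_0_left)

lemma sb_factor_pos: "m \<ge> 1 \<Longrightarrow> 0 < sb_factor m"
  using Sup_dual_value_ge_1[of m] by (simp add: sb_factor_eq)

lemma sb_factor_eqI: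
  assumes "q \<in> {0..<1}" "dual_value m q = x" "\<And>q. q \<in> {0..<1} \<Longrightarrow> dual_value m q \<le> x"
  shows "sb_factor m = inverse x"
  unfolding sb_factor_eq using assms
  by (subst cSup_eq_maximum[of x]) auto

lemma sb_factor_1: "sb_factor 1 = 1"
  by (subst sb_factor_eqI[of 0 1 1]) (auto simp: dual_value_def)

lemma sb_factor_2: "sb_factor 2 = 8 / 9"
proof -
  \<comment> \<open>The difference is \<open>2 * (q - 1 / 4) ^ 2\<close>.\<close>
  have "dual_value 2 q \<le> 9 / 8" for q
    using zero_le_square[of "q - 1 / 4"] by (simp add: dual_value_def power2_eq_square algebra_simps)
  then show ?thesis
    by (subst sb_factor_eqI[of "1 / 4" 2 "9 / 8"]) (auto simp: dual_value_def power2_eq_square)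
qed

lemma sb_factor_3: "sb_factor 3 = 27 / 32"
proof -
  have "dual_value 3 q \<le> 32 / 27" if "q \<in> {0..<1}" for q
  proof -
    \<comment> \<open>This product equals \<open>32 / 27 - dual_value 3 q\<close>, with a double
      root at the maximiser.\<close>
    have "0 \<le> (q - 1 / 3) ^ 2 * (q + 5 / 3)" using that by simp
    then show ?thesis
      by (simp add: dual_value_def power2_eq_square power3_eq_cube algebra_simps)
  qed
  then show ?thesis
    by (subst sb_factor_eqI[of "1 / 3" 3 "32 / 27"]) (auto simp: dual_value_def power2_eq_square power3_eq_cube)
qed

text \<open>For each fixed \<open>q\<close> the power \<open>q ^ m\<close> falls with
  \<open>m\<close>, so the supremum rises and its inverse falls.\<close>

lemma decseq_sb_factor: "decseq (\<lambda>m. sb_factor (Suc m))"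
proof (rule decseq_SucI)
  fix m
  have "(SUP q\<in>{0..<1}. dual_value (Suc m) q) \<le> (SUP q\<in>{0..<1}. dual_value (Suc (Suc m)) q)"
  proof (rule cSUP_mono[OF _ bdd_dual_value])
    fix q :: real assume q: "q \<in> {0..<1}"
    then have "q ^ Suc (Suc m) \<le> q ^ Suc m" by (intro power_decreasing) auto
    then show "\<exists>p\<in>{0..<1}. dual_value (Suc m) q \<le> dual_value (Suc (Suc m)) p"
      using q by (intro bexI[of _ q]) (auto simp: dual_value_def)
  qed simp
  then show "sb_factor (Suc (Suc m)) \<le> sb_factor (Suc m)"
    unfolding sb_factor_eq using Sup_dual_value_ge_1[of "Suc m"] by (intro le_imp_inverse_le) auto
qed

text \<open>The upper bound \<open>5 / 4\<close> on the supremum is approached at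
  \<open>q = 1 / 2\<close>, where only \<open>(1 / 2) ^ m\<close> is lost.\<close>

lemma tendsto_sb_factor: "sb_factor \<longlonglongrightarrow> 4 / 5"
proof -
  have "(\<lambda>m. SUP q\<in>{0..<1}. dual_value m q) \<longlonglongrightarrow> 5 / 4"
  proof (rule tendsto_sandwich)
    have "(\<lambda>m. 5 / 4 - (1 / 2) ^ m) \<longlonglongrightarrow> 5 / 4 - (0 :: real)"
      by (intro tendsto_intros LIMSEQ_power_zero) simp
    then show "(\<lambda>m. 5 / 4 - (1 / 2) ^ m) \<longlonglongrightarrow> (5 / 4 :: real)" by simp
    show "\<forall>\<^sub>F m in sequentially. 5 / 4 - (1 / 2) ^ m \<le> (SUP q\<in>{0..<1}. dual_value m q)"
      using dual_value_le_Sup[of "1 / 2"] by (auto simp: dual_value_def power2_eq_square)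
    show "\<forall>\<^sub>F m in sequentially. (SUP q\<in>{0..<1}. dual_value m q) \<le> 5 / 4"
      by (intro always_eventually allI cSUP_least dual_value_le) auto
  qed (rule tendsto_const)
  then have "(\<lambda>m. inverse (SUP q\<in>{0..<1}. dual_value m q)) \<longlonglongrightarrow> inverse (5 / 4)"
    by (intro tendsto_inverse) simp_all
  then show ?thesis by (simp add: sb_factor_eq[abs_def])
qed

section \<open>The lower bound on the second best\<close>

lemma SB_ge:
  assumes "m \<ge> 1" "market_class m K"
  shows "sb_factor m * FB K \<le> SB K"
proof -
  interpret binary_market K
    using assms(2) by unfold_locales (auto simp: market_class_def)
  have m: "card (set_pmf (cost_prior K j)) \<le> m" if "j \<in> sellers K" for j
    using assms(2) that by (simp add: market_class_def)
  let ?S = "SUP q\<in>{0..<1}. dual_value m q"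
  have S: "1 \<le> ?S" using Sup_dual_value_ge_1[OF assms(1)] .
  show ?thesis
  proof (cases "FB K = 0")
    case True
    then show ?thesis using GFT_le_SB[OF no_trade(1)] no_trade by simp
  next
    case False
    then have FB: "0 < FB K" using FB_nonneg by simp
    show ?thesis
    proof (rule SB_ge_dual)
      show "0 < sb_factor m * FB K" using FB sb_factor_pos[OF assms(1)] by simp
    next
      fix \<alpha> :: real assume \<alpha>: "0 \<le> \<alpha>" "\<alpha> \<le> 1"
      obtain A where A: "admissible A" "FB K \<le> ((\<Sum>s<m. \<alpha> ^ s) + \<alpha>) * lagrangian \<alpha> A"
        using lagrangian_bound[OF \<alpha> assms(1) m] by blast
      have C: "0 \<le> (\<Sum>s<m. \<alpha> ^ s) + \<alpha>" using \<alpha>(1) by (simp add: sum_nonneg)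
      \<comment> \<open>At \<alpha> = 1 this is the strictly positive revenue that
        \<open>SB_ge_dual\<close> demands.\<close>
      have pos: "0 < lagrangian \<alpha> A"
        using FB A(2) C by (metis less_le_trans linorder_not_le mult_nonneg_nonpos)
      have "(1 - \<alpha>) * FB K \<le> dual_value m \<alpha> * lagrangian \<alpha> A"
        using mult_left_mono[OF A(2), of "1 - \<alpha>"] \<alpha>(2) by (simp add: dual_value_eq mult.assoc)
      also have "\<dots> \<le> ?S * lagrangian \<alpha> A"
      \<comment> \<open>The supremum leaves out the point 1, but
        \<open>dual_value m 1 = 0\<close>.\<close>
      proof (cases "\<alpha> = 1")
        case True
        then show ?thesis using S pos by (simp add: dual_value_def)
      next
        case False
        then show ?thesis
          using pos \<alpha> by (intro mult_right_mono dual_value_le_Sup) auto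
      qed
      finally have "(1 - \<alpha>) * (sb_factor m * FB K) \<le> lagrangian \<alpha> A"
        using S by (simp add: sb_factor_eq field_simps)
      then show "\<exists>A. admissible A \<and> (1 - \<alpha>) * (sb_factor m * FB K) \<le> (1 - \<alpha>) * GFT K A + \<alpha> * revenue A
          \<and> (1 - \<alpha> = 0 \<longrightarrow> 0 < revenue A)"
        using A(1) pos by (intro exI[of _ A]) (auto simp: lagrangian_def)
    qed
  qed
qed

subsection \<open>Bilateral markets attaining the bound in the limit\<close>

text \<open>In a chain of length \<open>n\<close>, level \<open>l > 0\<close> with cost
  \<open>1 - \<rho> ^ l\<close> has probability
  \<open>(1 - \<epsilon>) * \<epsilon> ^ (n - l)\<close>, and level 0 with cost 0 has
  \<open>\<epsilon> ^ n\<close>. The recursion splits off the highest level, which leaves a shorter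
  chain for inductions.\<close>

primrec cost_chain :: "real \<Rightarrow> real \<Rightarrow> nat \<Rightarrow> real pmf" where
  "cost_chain \<epsilon> \<rho> 0 = return_pmf 0"
| "cost_chain \<epsilon> \<rho> (Suc n) =
    bernoulli_pmf \<epsilon> \<bind> (\<lambda>b. if b then cost_chain \<epsilon> \<rho> n else return_pmf (1 - \<rho> ^ Suc n))"

definition binary_value :: "real \<Rightarrow> real \<Rightarrow> real pmf" where
  "binary_value \<epsilon> \<rho> = map_pmf (\<lambda>b. if b then 1 else \<rho>) (bernoulli_pmf \<epsilon>)"

definition bilateral_market :: "'b \<Rightarrow> 's \<Rightarrow> real pmf \<Rightarrow> real pmf \<Rightarrow> ('b, 's) market" where
  "bilateral_market i j V C = \<lparr>buyers = {i}, sellers = {j}, edges = {(i, j)},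
     feasible = {{}, {(i, j)}}, value_prior = (\<lambda>_. V), cost_prior = (\<lambda>_. C)\<rparr>"

lemma bilateral_market_simps [simp]:
  "buyers (bilateral_market i j V C) = {i}" "sellers (bilateral_market i j V C) = {j}"
  "edges (bilateral_market i j V C) = {(i, j)}" "feasible (bilateral_market i j V C) = {{}, {(i, j)}}"
  "value_prior (bilateral_market i j V C) = (\<lambda>_. V)" "cost_prior (bilateral_market i j V C) = (\<lambda>_. C)"
  by (simp_all add: bilateral_market_def)

lemma bilateral_bilateral_market: "bilateral (bilateral_market i j V C)"
  by (auto simp: bilateral_def)

lemma matching_market_bilateral:
  assumes "finite (set_pmf V)" "finite (set_pmf C)"
  shows "matching_market (bilateral_market i j V C)"
  using assms by (auto simp: matching_market_def is_matching_def subset_singleton_iff)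

lemma expectation_pair_pmf_finite:
  fixes f :: "'a \<times> 'b \<Rightarrow> real"
  assumes "finite (set_pmf P)" "finite (set_pmf Q)"
  shows "measure_pmf.expectation (pair_pmf P Q) f =
    measure_pmf.expectation P (\<lambda>x. measure_pmf.expectation Q (\<lambda>y. f (x, y)))"
proof -
  have "pair_pmf P Q = P \<bind> (\<lambda>x. map_pmf (Pair x) Q)"
    by (simp add: pair_pmf_def map_pmf_def)
  then have "measure_pmf.expectation (pair_pmf P Q) f =
      (\<Sum>x\<in>set_pmf P. pmf P x * measure_pmf.expectation Q (\<lambda>y. f (x, y)))"
    using assms by (simp add: pmf_expectation_bind[of "set_pmf P"])
  also have "\<dots> = measure_pmf.expectation P (\<lambda>x. measure_pmf.expectation Q (\<lambda>y. f (x, y)))"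
    by (subst integral_measure_pmf_real[OF assms(1)]) (auto simp: mult.commute)
  finally show ?thesis .
qed

text \<open>The value of \<^term>\<open>\<rho>\<close> makes the virtual surplus of every pair of types except (high value, lowest
  cost) nonpositive, while successive costs contribute to the first best in a ratio that tends to
  \<^term>\<open>\<alpha>\<close> as \<^term>\<open>\<epsilon>\<close> tends to 0.\<close>

locale bilateral_example =
  fixes i :: 'b and j :: 's and n :: nat and \<epsilon> \<rho> \<alpha> :: real
  assumes eps: "0 < \<epsilon>" "\<epsilon> < 1" and alpha: "0 \<le> \<alpha>" "\<alpha> < 1"
    and rho: "\<rho> = \<alpha> * \<epsilon> / (1 - \<epsilon> + \<alpha> * \<epsilon>)"
begin

abbreviation "C \<equiv> cost_chain \<epsilon> \<rho>"
abbreviation "V \<equiv> binary_value \<epsilon> \<rho>"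
abbreviation "K \<equiv> bilateral_market i j V (C n)"

lemma denom_pos: "0 < 1 - \<epsilon> + \<alpha> * \<epsilon>"
  using eps alpha by (simp add: add_pos_nonneg)

text \<open>Equivalently \<open>\<rho> * (1 - \<epsilon>) = \<alpha> * \<epsilon> * (1 -
  \<rho>)\<close>: the virtual value of the low type is zero. The same cancellation occurs at each
  positive cost level against the high value.\<close>

lemma rho_mult: "\<rho> * (1 - \<epsilon> + \<alpha> * \<epsilon>) = \<alpha> * \<epsilon>"
  using denom_pos by (simp add: rho)

lemma rho_bounds: "\<alpha> * \<epsilon> \<le> \<rho>" "0 \<le> \<rho>" "\<rho> < 1"
proof -
  show "\<alpha> * \<epsilon> \<le> \<rho>" unfolding rho pos_le_divide_eq[OF denom_pos]
    using eps alpha by (intro mult_left_le) auto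
  then show "0 \<le> \<rho>" using eps alpha by (meson mult_nonneg_nonneg less_imp_le order_trans)
  show "\<rho> < 1" unfolding rho pos_divide_less_eq[OF denom_pos] using eps by simp
qed

lemma set_cost_chain: "set_pmf (C k) = (\<lambda>l. 1 - \<rho> ^ l) ` {..k}"
proof (induction k)
  case (Suc k)
  have "set_pmf (C (Suc k)) = insert (1 - \<rho> ^ Suc k) (set_pmf (C k))"
    using eps by (auto simp: set_bind_pmf UNIV_bool)
  then show ?case using Suc by (simp add: atMost_Suc)
qed simp

lemma set_binary_value: "set_pmf V = {1, \<rho>}"
  using eps by (auto simp: binary_value_def UNIV_bool)

lemma finite_supports [simp]: "finite (set_pmf V)" "finite (set_pmf (C k))"
  by (simp_all add: set_binary_value set_cost_chain)

lemma market_class: "market_class (Suc n) K"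
proof -
  have "card (set_pmf (C n)) \<le> Suc n"
    unfolding set_cost_chain using card_image_le[of "{..n}" "\<lambda>k. 1 - \<rho> ^ k"] by simp
  then show ?thesis
    using matching_market_bilateral[OF finite_supports] rho_bounds(3)
    by (simp add: market_class_def set_binary_value)
qed

sublocale finite_market K
  using market_class by unfold_locales (simp add: market_class_def)

abbreviation EC :: "nat \<Rightarrow> (real \<Rightarrow> real) \<Rightarrow> real" where
  "EC k \<equiv> measure_pmf.expectation (C k)"

lemma integrable_C [simp]: "integrable (measure_pmf (C k)) (f :: real \<Rightarrow> real)"
  by (rule integrable_measure_pmf_finite) simp

lemma EC_mono: "(\<And>y. y \<in> set_pmf (C k) \<Longrightarrow> f y \<le> g y) \<Longrightarrow> EC k f \<le> EC k g"
  by (rule integral_mono_AE) (auto simp: AE_measure_pmf_iff)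

lemma EC_Suc: "EC (Suc k) f = \<epsilon> * EC k f + (1 - \<epsilon>) * f (1 - \<rho> ^ Suc k)"
  using eps by (simp add: pmf_expectation_bind[of "UNIV :: bool set"] UNIV_bool del: power_Suc)

text \<open>Only the descent to level 0, of probability \<open>\<epsilon> ^ k\<close>, is
  kept.\<close>

lemma EC_ge: "(\<And>y. 0 \<le> f y) \<Longrightarrow> \<epsilon> ^ k * f 0 \<le> EC k f"
proof (induction k)
  case (Suc k)
  have "\<epsilon> ^ Suc k * f 0 \<le> \<epsilon> * EC k f"
    using mult_left_mono[OF Suc.IH[OF Suc.prems], of \<epsilon>] eps by (simp add: mult.assoc)
  also have "\<dots> \<le> EC (Suc k) f"
    unfolding EC_Suc using eps Suc.prems by simp
  finally show ?case .
qed simp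

definition val :: "real \<Rightarrow> 'b \<Rightarrow> real" where "val x = (\<lambda>b. if b = i then x else 0)"
definition cst :: "real \<Rightarrow> 's \<Rightarrow> real" where "cst y = (\<lambda>s. if s = j then y else 0)"

lemma val_upd [simp]: "val x i = x" "(val x)(i := r) = val r"
  and cst_upd [simp]: "cst y j = y" "(cst y)(j := r) = cst r"
  by (auto simp: val_def cst_def)

lemma expect_K: "expect K f = \<epsilon> * EC n (\<lambda>y. f (val 1, cst y)) + (1 - \<epsilon>) * EC n (\<lambda>y. f (val \<rho>, cst y))"
proof -
  have "profiles K = map_pmf (\<lambda>(x, y). (val x, cst y)) (pair_pmf V (C n))"
    unfolding profiles_def by (simp add: Pi_pmf_singleton val_def[abs_def] cst_def[abs_def] map_pair)
  then have "expect K f = measure_pmf.expectation V (\<lambda>x. EC n (\<lambda>y. f (val x, cst y)))"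
    by (simp add: case_prod_unfold expectation_pair_pmf_finite)
  also have "\<dots> = \<epsilon> * EC n (\<lambda>y. f (val 1, cst y)) + (1 - \<epsilon>) * EC n (\<lambda>y. f (val \<rho>, cst y))"
    unfolding binary_value_def using eps by simp
  finally show ?thesis .
qed

text \<open>A positive level \<open>l\<close> contributes
  \<open>(1 - \<epsilon>) * \<epsilon> ^ (k - l) * \<rho> ^ l\<close>, and \<open>\<rho>\<close> is
  at least \<open>\<alpha> * \<epsilon>\<close>; the leading 1 stems from cost 0.\<close>

lemma EC_surplus: "\<epsilon> ^ k * (1 + (1 - \<epsilon>) * (\<Sum>l=1..k. \<alpha> ^ l)) \<le> EC k (\<lambda>y. 1 - y)"
proof (induction k)
  case (Suc k)
  have "\<epsilon> ^ Suc k * \<alpha> ^ Suc k \<le> \<rho> ^ Suc k"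
    using power_mono[OF rho_bounds(1), of "Suc k"] eps alpha by (simp add: power_mult_distrib mult_ac)
  then have "(1 - \<epsilon>) * (\<epsilon> ^ Suc k * \<alpha> ^ Suc k) \<le> (1 - \<epsilon>) * \<rho> ^ Suc k"
    using eps by (intro mult_left_mono) auto
  moreover have "\<epsilon> * (\<epsilon> ^ k * (1 + (1 - \<epsilon>) * (\<Sum>l=1..k. \<alpha> ^ l))) \<le> \<epsilon> * EC k (\<lambda>y. 1 - y)"
    using Suc eps by (intro mult_left_mono) auto
  ultimately show ?case
    unfolding EC_Suc by (simp add: algebra_simps del: integral_diff Bochner_Integration.integral_diff)
qed simp

text \<open>Trade of the high value at every cost yields the geometric sum; trade of the low value
  at cost 0 yields the extra \<alpha>.\<close>

lemma FB_ge: "\<epsilon> ^ Suc n * ((1 - \<epsilon>) * ((\<Sum>s<Suc n. \<alpha> ^ s) + \<alpha>)) \<le> FB K"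
proof -
  have FB: "FB K = \<epsilon> * EC n (\<lambda>y. max 0 (1 - y)) + (1 - \<epsilon>) * EC n (\<lambda>y. max 0 (\<rho> - y))"
    unfolding FB_def expect_K by simp
  have "EC n (\<lambda>y. 1 - y) \<le> EC n (\<lambda>y. max 0 (1 - y))" by (rule EC_mono) simp
  then have 1: "\<epsilon> * (\<epsilon> ^ n * (1 + (1 - \<epsilon>) * (\<Sum>l=1..n. \<alpha> ^ l))) \<le> \<epsilon> * EC n (\<lambda>y. max 0 (1 - y))"
    using EC_surplus[of n] eps by (intro mult_left_mono) auto
  have "\<epsilon> ^ n * \<rho> \<le> EC n (\<lambda>y. max 0 (\<rho> - y))"
    using EC_ge[of "\<lambda>y. max 0 (\<rho> - y)" n] rho_bounds(2) by simp
  then have "\<epsilon> ^ n * (\<alpha> * \<epsilon>) \<le> EC n (\<lambda>y. max 0 (\<rho> - y))"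
    by (rule order_trans[rotated]) (use rho_bounds(1) eps in \<open>auto intro: mult_left_mono\<close>)
  then have 2: "(1 - \<epsilon>) * (\<epsilon> ^ n * (\<alpha> * \<epsilon>)) \<le> (1 - \<epsilon>) * EC n (\<lambda>y. max 0 (\<rho> - y))"
    using eps by (intro mult_left_mono) auto
  have S: "(\<Sum>s<Suc n. \<alpha> ^ s) = 1 + (\<Sum>l=1..n. \<alpha> ^ l)"
    by (simp add: lessThan_Suc_atMost atMost_atLeast0 sum.atLeast_Suc_atMost)
  \<comment> \<open>The term of the high value at cost 0 lacks the factor
    \<open>1 - \<epsilon>\<close>; supplying it costs \<open>\<epsilon> ^ (n + 2)\<close>.\<close>
  have "\<epsilon> ^ Suc n * ((1 - \<epsilon>) * ((\<Sum>s<Suc n. \<alpha> ^ s) + \<alpha>)) =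
      \<epsilon> * (\<epsilon> ^ n * (1 + (1 - \<epsilon>) * (\<Sum>l=1..n. \<alpha> ^ l))) + (1 - \<epsilon>) * (\<epsilon> ^ n * (\<alpha> * \<epsilon>)) - \<epsilon> ^ Suc n * \<epsilon>"
    unfolding S by (simp add: algebra_simps)
  also have "\<dots> \<le> FB K"
    using 1 2 zero_le_power[of \<epsilon> "Suc (Suc n)"] eps unfolding FB power_Suc2[of \<epsilon> "Suc n"] by linarith
  finally show ?thesis .
qed

text \<open>The downward adjacent incentive constraints of the seller, weighted so that the
  coefficients of all allocations except that of the lowest cost vanish.\<close>

lemma seller_chain:
  fixes Y U :: "real \<Rightarrow> real"
  assumes IC: "\<And>l. l < k \<Longrightarrow>
    U (1 - \<rho> ^ Suc l) + (\<rho> ^ l - \<rho> ^ Suc l) * Y (1 - \<rho> ^ Suc l) \<le> U (1 - \<rho> ^ l)"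
  shows "EC k (\<lambda>y. (1 - y) * Y y - \<alpha> * U y) \<le> \<epsilon> ^ k * Y 0 - \<alpha> * U (1 - \<rho> ^ k)"
  using IC
proof (induction k)
  case (Suc k)
  define u where "u = U (1 - \<rho> ^ k)"
  define u' where "u' = U (1 - \<rho> ^ Suc k)"
  define y where "y = Y (1 - \<rho> ^ Suc k)"
  define r where "r = \<rho> ^ k"
  have IH: "EC k (\<lambda>y. (1 - y) * Y y - \<alpha> * U y) \<le> \<epsilon> ^ k * Y 0 - \<alpha> * u"
    unfolding u_def by (rule Suc.IH) (use Suc.prems in simp)
  have "u' + (r - r * \<rho>) * y \<le> u"
    using Suc.prems[of k] by (simp add: u_def u'_def y_def r_def mult.commute)
  \<comment> \<open>The weight is the coefficient of \<open>u\<close> in the induction hypothesis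
    after multiplication by \<epsilon>, so that \<open>u\<close> cancels; \<open>rho_mult\<close>
    then removes \<open>y\<close>.\<close>
  then have "\<epsilon> * \<alpha> * (u' + (r - r * \<rho>) * y) \<le> \<epsilon> * \<alpha> * u"
    using eps alpha by (intro mult_left_mono) auto
  moreover have "\<epsilon> * EC k (\<lambda>y. (1 - y) * Y y - \<alpha> * U y) \<le> \<epsilon> * (\<epsilon> ^ k * Y 0 - \<alpha> * u)"
    using IH eps by (intro mult_left_mono) auto
  moreover have "EC (Suc k) (\<lambda>y. (1 - y) * Y y - \<alpha> * U y) =
      \<epsilon> * EC k (\<lambda>y. (1 - y) * Y y - \<alpha> * U y) + (1 - \<epsilon>) * (r * \<rho> * y - \<alpha> * u')"
    unfolding EC_Suc by (simp add: u'_def y_def r_def mult.commute)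
  moreover have "(1 - \<epsilon>) * (r * \<rho> * y) - \<epsilon> * \<alpha> * ((r - r * \<rho>) * y) =
      r * y * (\<rho> * (1 - \<epsilon> + \<alpha> * \<epsilon>) - \<alpha> * \<epsilon>)"
    by (simp add: algebra_simps)
  then have "(1 - \<epsilon>) * (r * \<rho> * y) = \<epsilon> * \<alpha> * ((r - r * \<rho>) * y)"
    unfolding rho_mult by simp
  ultimately show ?case
    unfolding u'_def[symmetric] by (simp add: algebra_simps)
qed simp

text \<open>Weak duality: nonnegative revenue may be added with weight \<alpha>, and a few incentive
  and participation constraints bound the resulting Lagrangian. By the choice of \<rho>, only the
  trade of the high value at cost 0 is left.\<close>

lemma GFT_le:
  assumes A: "admissible A" "0 \<le> revenue A"
  shows "(1 - \<alpha>) * GFT K A \<le> \<epsilon> ^ Suc n"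
proof -
  define X where "X x y = edge_prob A (val x, cst y) i j" for x y
  define pb where "pb x y = buyer_pay A (val x, cst y) i" for x y
  define ps where "ps x y = seller_pay A (val x, cst y) j" for x y
  have X: "0 \<le> X x y" "X x y \<le> 1" for x y by (auto simp: X_def edge_prob_def)
  have bu: "buyer_util K A i x r = x * EC n (X r) - EC n (pb r)" for x r
    unfolding buyer_util_def expect_K using eps
    by (simp add: buyer_prob_def X_def[symmetric] pb_def[symmetric] algebra_simps)
  have su: "seller_util K A j x r = \<epsilon> * (- x * X 1 r - ps 1 r) + (1 - \<epsilon>) * (- x * X \<rho> r - ps \<rho> r)" for x r
    unfolding seller_util_def expect_K
    by (simp add: seller_prob_def X_def[symmetric] ps_def[symmetric])
  define Y where "Y y = \<epsilon> * X 1 y + (1 - \<epsilon>) * X \<rho> y" for y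
  define U where "U y = seller_util K A j y y" for y
  define Q where "Q x = EC n (X x)" for x
  have GFT: "GFT K A = \<epsilon> * (Q 1 - EC n (\<lambda>y. y * X 1 y)) + (1 - \<epsilon>) * (\<rho> * Q \<rho> - EC n (\<lambda>y. y * X \<rho> y))"
    unfolding GFT_def expect_K by (simp add: X_def[symmetric] Q_def left_diff_distrib)
  have rev: "revenue A = \<epsilon> * (EC n (pb 1) + EC n (ps 1)) + (1 - \<epsilon>) * (EC n (pb \<rho>) + EC n (ps \<rho>))"
    unfolding revenue_def expect_K by (simp add: pb_def[abs_def] ps_def[abs_def])
  have EU: "EC n U = \<epsilon> * (- EC n (\<lambda>y. y * X 1 y) - EC n (ps 1)) +
      (1 - \<epsilon>) * (- EC n (\<lambda>y. y * X \<rho> y) - EC n (ps \<rho>))"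
    unfolding U_def su by simp
  have EY: "EC n Y = \<epsilon> * Q 1 + (1 - \<epsilon>) * Q \<rho>"
    unfolding Y_def Q_def by simp
  have EyY: "EC n (\<lambda>y. (1 - y) * Y y - \<alpha> * U y) = EC n Y - (\<epsilon> * EC n (\<lambda>y. y * X 1 y) +
      (1 - \<epsilon>) * EC n (\<lambda>y. y * X \<rho> y)) - \<alpha> * EC n U"
  proof -
    have "EC n (\<lambda>y. (1 - y) * Y y - \<alpha> * U y) =
        EC n (\<lambda>y. Y y - (\<epsilon> * (y * X 1 y) + (1 - \<epsilon>) * (y * X \<rho> y)) - \<alpha> * U y)"
      by (rule arg_cong[of _ _ "EC n"]) (auto simp: Y_def algebra_simps)
    then show ?thesis by simp
  qed
  have BIC: "BIC K A" and IIR: "IIR K A" using A(1) by (simp_all add: admissible_def)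
  have Ub: "0 \<le> \<rho> * Q \<rho> - EC n (pb \<rho>)" "1 * Q \<rho> - EC n (pb \<rho>) \<le> 1 * Q 1 - EC n (pb 1)"
    using BIC IIR by (simp_all add: BIC_def IIR_def set_binary_value bu Q_def)
  have mem: "1 - \<rho> ^ l \<in> set_pmf (C n)" if "l \<le> n" for l
    using that by (auto simp: set_cost_chain)
  have "EC n (\<lambda>y. (1 - y) * Y y - \<alpha> * U y) \<le> \<epsilon> ^ n * Y 0 - \<alpha> * U (1 - \<rho> ^ n)"
  proof (rule seller_chain)
    fix l assume l: "l < n"
    have "seller_util K A j (1 - \<rho> ^ l) (1 - \<rho> ^ Suc l) \<le> U (1 - \<rho> ^ l)"
      using BIC mem[of l] mem[of "Suc l"] l by (simp add: BIC_def U_def del: power_Suc)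
    then show "U (1 - \<rho> ^ Suc l) + (\<rho> ^ l - \<rho> ^ Suc l) * Y (1 - \<rho> ^ Suc l) \<le> U (1 - \<rho> ^ l)"
      by (simp add: U_def su Y_def algebra_simps)
  qed
  moreover have "0 \<le> \<alpha> * U (1 - \<rho> ^ n)"
    using IIR mem[of n] alpha by (simp add: IIR_def U_def)
  ultimately have chain: "EC n (\<lambda>y. (1 - y) * Y y - \<alpha> * U y) \<le> \<epsilon> ^ n * Y 0" by linarith
  have "(1 - \<alpha>) * GFT K A \<le> (1 - \<alpha>) * GFT K A + \<alpha> * revenue A"
    using A(2) alpha by simp
  also have "\<dots> = \<epsilon> * Q 1 + (1 - \<epsilon>) * \<rho> * Q \<rho> - EC n Y + EC n (\<lambda>y. (1 - y) * Y y - \<alpha> * U y)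
      - \<alpha> * (\<epsilon> * (1 * Q 1 - EC n (pb 1)) + (1 - \<epsilon>) * (\<rho> * Q \<rho> - EC n (pb \<rho>)))"
    unfolding GFT rev EU EY EyY by (simp add: algebra_simps)
  also have "\<dots> \<le> \<epsilon> * Q 1 + (1 - \<epsilon>) * \<rho> * Q \<rho> - EC n Y + \<epsilon> ^ n * Y 0 - \<alpha> * (\<epsilon> * ((1 - \<rho>) * Q \<rho>))"
  proof -
    \<comment> \<open>The high type can imitate the low one, whose utility is nonnegative, and so
      earns at least the value gap times \<open>Q \<rho>\<close>.\<close>
    have "\<epsilon> * ((1 - \<rho>) * Q \<rho>) \<le> \<epsilon> * (1 * Q 1 - EC n (pb 1))"
      using Ub eps by (intro mult_left_mono) (auto simp: algebra_simps)
    moreover have "0 \<le> (1 - \<epsilon>) * (\<rho> * Q \<rho> - EC n (pb \<rho>))"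
      using Ub eps by simp
    ultimately have "\<alpha> * (\<epsilon> * ((1 - \<rho>) * Q \<rho>)) \<le>
        \<alpha> * (\<epsilon> * (1 * Q 1 - EC n (pb 1)) + (1 - \<epsilon>) * (\<rho> * Q \<rho> - EC n (pb \<rho>)))"
      using alpha by (intro mult_left_mono) auto
    then show ?thesis using chain by linarith
  qed
  \<comment> \<open>The last factor is the low type's virtual value up to scaling, hence
    zero.\<close>
  also have "\<dots> = \<epsilon> ^ n * Y 0 - (1 - \<epsilon>) * Q \<rho> + Q \<rho> * (\<rho> * (1 - \<epsilon> + \<alpha> * \<epsilon>) - \<alpha> * \<epsilon>)"
    unfolding EY by (simp add: algebra_simps)
  also have "\<dots> = \<epsilon> ^ n * Y 0 - (1 - \<epsilon>) * Q \<rho>"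
    unfolding rho_mult by simp
  \<comment> \<open>Keeping only cost 0 in \<open>Q \<rho>\<close> is just enough to cancel the
    low-value part of \<open>Y 0\<close>.\<close>
  also have "\<dots> \<le> \<epsilon> ^ n * Y 0 - (1 - \<epsilon>) * (\<epsilon> ^ n * X \<rho> 0)"
    using EC_ge[of "X \<rho>" n] X eps unfolding Q_def by (intro diff_left_mono mult_left_mono) auto
  also have "\<dots> = \<epsilon> ^ Suc n * X 1 0"
    by (simp add: Y_def algebra_simps)
  also have "\<dots> \<le> \<epsilon> ^ Suc n"
    using X eps by (intro mult_left_le) auto
  finally show ?thesis .
qed

lemma SB_FB_bound: "(1 - \<epsilon>) * dual_value (Suc n) \<alpha> * SB K \<le> FB K"
proof -
  have pos: "0 < 1 - \<alpha>" using alpha by simp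
  have "SB K \<le> \<epsilon> ^ Suc n / (1 - \<alpha>)"
    by (rule SB_le) (use GFT_le pos in \<open>simp only: pos_le_divide_eq mult.commute[of _ "1 - \<alpha>"]\<close>)
  then have "(1 - \<alpha>) * SB K \<le> \<epsilon> ^ Suc n"
    unfolding pos_le_divide_eq[OF pos] by (simp only: mult.commute)
  moreover have nn: "0 \<le> (1 - \<epsilon>) * ((\<Sum>s<Suc n. \<alpha> ^ s) + \<alpha>)"
    using eps alpha by (intro mult_nonneg_nonneg add_nonneg_nonneg sum_nonneg) auto
  ultimately have "(1 - \<epsilon>) * ((\<Sum>s<Suc n. \<alpha> ^ s) + \<alpha>) * ((1 - \<alpha>) * SB K) \<le>
      (1 - \<epsilon>) * ((\<Sum>s<Suc n. \<alpha> ^ s) + \<alpha>) * \<epsilon> ^ Suc n"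
    by (intro mult_left_mono)
  also have "\<dots> \<le> FB K" using FB_ge by (simp only: mult.commute)
  finally show ?thesis by (simp only: dual_value_eq mult_ac)
qed

lemma FB_pos: "0 < FB K"
proof -
  have "0 < (\<Sum>s<Suc n. \<alpha> ^ s) + \<alpha>"
    unfolding sum.lessThan_Suc_shift using alpha by (simp add: add_pos_nonneg sum_nonneg)
  then have "0 < \<epsilon> ^ Suc n * ((1 - \<epsilon>) * ((\<Sum>s<Suc n. \<alpha> ^ s) + \<alpha>))"
    using eps by simp
  then show ?thesis using FB_ge by linarith
qed

end

section \<open>The infimum of the ratio\<close>

lemma ratio_Inf_le:
  assumes "m \<ge> 1"
    and lower: "\<And>K :: ('b, 's) market. market_class m K \<Longrightarrow> bilateral K \<Longrightarrow> 0 < FB K \<Longrightarrow> x \<le> SB K / FB K"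
    and x: "0 < x"
  shows "x \<le> sb_factor m"
proof -
  obtain n where m: "m = Suc n" using assms(1) by (cases m) auto
  have le: "(1 - \<epsilon>) * (dual_value m \<alpha> * x) \<le> 1" if \<epsilon>: "0 < \<epsilon>" "\<epsilon> < 1" and \<alpha>: "\<alpha> \<in> {0..<1}" for \<epsilon> \<alpha>
  proof -
    \<comment> \<open>Types are inhabited, so \<open>undefined\<close> serves as the one buyer and
      the one seller.\<close>
    interpret bilateral_example "undefined :: 'b" "undefined :: 's" n \<epsilon> "\<alpha> * \<epsilon> / (1 - \<epsilon> + \<alpha> * \<epsilon>)" \<alpha>
      using \<epsilon> \<alpha> by unfold_locales auto
    have "x \<le> SB K / FB K"
      using lower[OF market_class[folded m] bilateral_bilateral_market FB_pos] .
    moreover have "0 \<le> dual_value m \<alpha>"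
      unfolding dual_value_eq using \<alpha> by (intro mult_nonneg_nonneg add_nonneg_nonneg sum_nonneg) auto
    ultimately have "(1 - \<epsilon>) * dual_value m \<alpha> * x \<le> (1 - \<epsilon>) * dual_value m \<alpha> * (SB K / FB K)"
      using \<epsilon> by (intro mult_left_mono) auto
    also have "\<dots> = (1 - \<epsilon>) * dual_value m \<alpha> * SB K / FB K" by simp
    also have "\<dots> \<le> 1"
      unfolding pos_divide_le_eq[OF FB_pos] using SB_FB_bound[folded m] by simp
    finally show ?thesis by (simp add: mult.assoc)
  qed
  \<comment> \<open>For fixed \<alpha> the limit \<epsilon> to 0 removes the factor
    \<open>1 - \<epsilon>\<close>; the supremum over \<alpha> comes afterwards.\<close>
  have "dual_value m \<alpha> * x \<le> 1" if "\<alpha> \<in> {0..<1}" for \<alpha>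
  proof (rule tendsto_upperbound)
    have "((\<lambda>\<epsilon>. (1 - \<epsilon>) * (dual_value m \<alpha> * x)) \<longlongrightarrow> (1 - 0) * (dual_value m \<alpha> * x)) (at_right 0)"
      by (intro tendsto_intros)
    then show "((\<lambda>\<epsilon>. (1 - \<epsilon>) * (dual_value m \<alpha> * x)) \<longlongrightarrow> dual_value m \<alpha> * x) (at_right 0)" by simp
    show "\<forall>\<^sub>F \<epsilon> in at_right 0. (1 - \<epsilon>) * (dual_value m \<alpha> * x) \<le> 1"
      unfolding eventually_at_right_field using le[OF _ _ that] by (intro exI[of _ 1]) auto
  qed simp
  then have "(SUP q\<in>{0..<1}. dual_value m q) \<le> 1 / x"
    using x by (intro cSUP_least) (auto simp: field_simps)
  then have "x * (SUP q\<in>{0..<1}. dual_value m q) \<le> 1"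
    using x by (simp add: field_simps)
  then show ?thesis
    using Sup_dual_value_ge_1[OF assms(1)] unfolding sb_factor_eq by (simp add: field_simps)
qed

text \<open>The predicate \<open>P\<close> serves both infima, over the whole class and over
  bilateral markets: the lower bound holds throughout, and the extremal examples are
  bilateral.\<close>

lemma sb_factor_eq_Inf:
  assumes "m \<ge> 1"
    and P: "\<And>K :: ('b, 's) market. bilateral K \<Longrightarrow> P K"
  shows "sb_factor m = Inf {SB K / FB K | K :: ('b, 's) market. market_class m K \<and> P K \<and> 0 < FB K}"
    (is "_ = Inf ?R")
proof (rule antisym)
  have lower: "sb_factor m \<le> SB K / FB K" if "market_class m K" "0 < FB K" for K :: "('b, 's) market"
    using SB_ge[OF assms(1) that(1)] that(2) by (simp add: field_simps)
  have "?R \<noteq> {}"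
  proof -
    obtain n where m: "m = Suc n" using assms(1) by (cases m) auto
    \<comment> \<open>One concrete instance shows that the infimum is taken over a nonempty
      set.\<close>
    interpret bilateral_example "undefined :: 'b" "undefined :: 's" n "1 / 2" 0 0
      by unfold_locales auto
    have "SB K / FB K \<in> ?R"
      using market_class[folded m] FB_pos P[OF bilateral_bilateral_market] by blast
    then show ?thesis by blast
  qed
  then show ge: "sb_factor m \<le> Inf ?R"
    using lower by (intro cInf_greatest) auto
  have bdd: "bdd_below ?R" using lower by (intro bdd_belowI[of _ "sb_factor m"]) auto
  show "Inf ?R \<le> sb_factor m"
  proof (rule ratio_Inf_le[OF assms(1)])
    fix K :: "('b, 's) market" assume "market_class m K" "bilateral K" "0 < FB K"
    then show "Inf ?R \<le> SB K / FB K" using P by (intro cInf_lower[OF _ bdd]) blast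
  qed (use ge sb_factor_pos[OF assms(1)] in linarith)
qed

theorem theorem1p4:
  shows "(\<forall>m\<ge>1.
            (\<forall>K :: ('b, 's) market. market_class m K \<longrightarrow> SB K \<ge> sb_factor m * FB K) \<and>
            sb_factor m = Inf {SB K / FB K | K :: ('b, 's) market. market_class m K \<and> FB K > 0} \<and>
            sb_factor m = Inf {SB K / FB K | K :: ('b, 's) market.
                                 market_class m K \<and> bilateral K \<and> FB K > 0}) \<and>
         sb_factor 1 = 1 \<and> sb_factor 2 = 8 / 9 \<and> sb_factor 3 = 27 / 32 \<and>
         decseq (\<lambda>m. sb_factor (Suc m)) \<and> sb_factor \<longlonglongrightarrow> 4 / 5"
proof (intro conjI allI impI)
  fix m :: nat assume m: "1 \<le> m"
  show "sb_factor m * FB K \<le> SB K" if "market_class m K" for K :: "('b, 's) market"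
    using SB_ge[OF m that] .
  show "sb_factor m = Inf {SB K / FB K | K :: ('b, 's) market. market_class m K \<and> FB K > 0}"
    using sb_factor_eq_Inf[OF m, of "\<lambda>_ :: ('b, 's) market. True"] by simp
  show "sb_factor m = Inf {SB K / FB K | K :: ('b, 's) market.
      market_class m K \<and> bilateral K \<and> FB K > 0}"
    by (rule sb_factor_eq_Inf[OF m])
qed (fact sb_factor_1 sb_factor_2 sb_factor_3 decseq_sb_factor tendsto_sb_factor)+

end
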